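(* Assume the expert is allowed to make a prediction at every period, and let $\Xi(T)$ denote the a priori expected total reward (averaged over all signal realizations) of an expert who follows the optimal strategy, namely predicting truthfully at every period $T,T-1,\dots,1$. Then $$\Xi(T)=\frac12\sum_{t=1}^T\log\frac{t}{t-q}=\frac12\log\frac{\Gamma(1-q)\,\Gamma(T+1)}{\Gamma(T+1-q)},$$ so $\Xi(T)=O(\log T)$, and more precisely $$\lim_{T\to\infty}\frac{\Xi(T)}{q\log T+\log\Gamma(1-q)}=\frac12.$$
   Context: Model. Fix a quality parameter $q\in(0,1)$. Time is discrete and runs backwards $T,\dots,1,0$. Let $X_0$ be the outcome, and let $A_1,\dots,A_T,B_1,\dots,B_T$ be mutually independent random variables, independent of $X_0$, with $A_\tau\sim N(0,q)$ and $B_\tau\sim N(0,1-q)$. The market signal at time $t$ is $X_t=X_0+\sum_{\tau=1}^t(A_\tau+B_\tau)$ and the expert's private signal is $Y_t=X_0+\sum_{\tau=1}^t B_\tau$; lowercase $x_t,y_t$ denote realized values. The prior on $X_0$ is $N(0,\sigma_0^2)$ in the limit $\sigma_0^2\to\infty$ (a flat prior), so that posteriors of $X_0$ are determined by observed signals alone. At each time $t$, $x_t$ becomes common knowledge while $y_t$ is known only to the expert. A truthful prediction at time $t$ announces $y_t$, implicitly declaring the distribution $N(y_t,(1-q)t)$; the market is Bayesian and treats announcements as truthful. If the market's density for $X_0$ immediately before a prediction at time $t$ is $f_-$ and immediately after is $f_+$, the reward for that prediction is $W_t=\log(f_+(x_0)/f_-(x_0))$; the expert's total reward is the sum over all his predictions.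 $\Gamma$ is the Euler Gamma function. *)

theory Defs
  imports "HOL-Probability.Probability" "HOL-Library.Landau_Symbols"
begin

datatype src = S0 | SA nat | SB nat

definition sources :: "('a \<Rightarrow> real) \<Rightarrow> (nat \<Rightarrow> 'a \<Rightarrow> real) \<Rightarrow> (nat \<Rightarrow> 'a \<Rightarrow> real)
    \<Rightarrow> src \<Rightarrow> 'a \<Rightarrow> real" where
  "sources X0 A B i = (case i of S0 \<Rightarrow> X0 | SA \<tau> \<Rightarrow> A \<tau> | SB \<tau> \<Rightarrow> B \<tau>)"

definition src_index :: "src set" where
  "src_index = {S0} \<union> {SA \<tau> | \<tau>. 1 \<le> \<tau>} \<union> {SB \<tau> | \<tau>. 1 \<le> \<tau>}"

text \<open>Observable signals: the market signal X_t and the expert's signal Y_t.\<close>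
datatype obs = Xo nat | Yo nat

definition signal :: "('a \<Rightarrow> real) \<Rightarrow> (nat \<Rightarrow> 'a \<Rightarrow> real) \<Rightarrow> (nat \<Rightarrow> 'a \<Rightarrow> real)
    \<Rightarrow> obs \<Rightarrow> 'a \<Rightarrow> real" where
  "signal X0 A B ob \<omega> = (case ob of
      Xo t \<Rightarrow> X0 \<omega> + (\<Sum>\<tau>\<in>{1..t}. A \<tau> \<omega> + B \<tau> \<omega>)
    | Yo t \<Rightarrow> X0 \<omega> + (\<Sum>\<tau>\<in>{1..t}. B \<tau> \<omega>))"

text \<open>Public information immediately before / after the (truthful) prediction at time t,
  when the horizon is T: x_T,...,x_t and the announcements y_T,...,y_(t+1) (resp. y_t).\<close>
definition info_before :: "nat \<Rightarrow> nat \<Rightarrow> obs set" where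
  "info_before T t = {Xo s | s. t \<le> s \<and> s \<le> T} \<union> {Yo s | s. t < s \<and> s \<le> T}"

definition info_after :: "nat \<Rightarrow> nat \<Rightarrow> obs set" where
  "info_after T t = {Xo s | s. t \<le> s \<and> s \<le> T} \<union> {Yo s | s. t \<le> s \<and> s \<le> T}"

definition gen_sigma :: "'a measure \<Rightarrow> ('i \<Rightarrow> 'a \<Rightarrow> real) \<Rightarrow> 'i set \<Rightarrow> 'a measure" where
  "gen_sigma M Z I = sigma (space M) {Z i -` S \<inter> space M | i S. i \<in> I \<and> S \<in> sets borel}"

definition cond_density :: "'a measure \<Rightarrow> 'a measure \<Rightarrow> ('a \<Rightarrow> real) \<Rightarrow> ('a \<Rightarrow> real \<Rightarrow> real) \<Rightarrow> bool" where
  "cond_density M F X h \<longleftrightarrow>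
     (\<lambda>(\<omega>, x). h \<omega> x) \<in> borel_measurable (F \<Otimes>\<^sub>M borel) \<and>
     (\<forall>\<omega> x. 0 \<le> h \<omega> x) \<and>
     (\<forall>E \<in> sets F. \<forall>S \<in> sets borel.
        emeasure M (E \<inter> (X -` S \<inter> space M)) =
        (\<integral>\<^sup>+ \<omega>\<in>E. (\<integral>\<^sup>+ x\<in>S. ennreal (h \<omega> x) \<partial>lborel) \<partial>M))"

text \<open>Expected total log-score reward of the truthful expert with horizon T, where
  hm t / hp t are the market densities immediately before / after the prediction at time t:
  sum over t of log (f_+(x_0) / f_-(x_0)).\<close>
definition expected_reward :: "'a measure \<Rightarrow> ('a \<Rightarrow> real) \<Rightarrow> (nat \<Rightarrow> 'a \<Rightarrow> real \<Rightarrow> real)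
    \<Rightarrow> (nat \<Rightarrow> 'a \<Rightarrow> real \<Rightarrow> real) \<Rightarrow> nat \<Rightarrow> real" where
  "expected_reward M X0 hm hp T =
     (\<integral>\<omega>. (\<Sum>t\<in>{1..T}. ln (hp t \<omega> (X0 \<omega>)) - ln (hm t \<omega> (X0 \<omega>))) \<partial>M)"

end

theory Submission
  imports Defs
begin

text \<open>
  All signals are linear combinations of independent centred Gaussians, so the residual
  of \<open>X0\<close> after its regression on the public signals, being uncorrelated with them, is
  independent of them. The market density is therefore normal around the regression mean with the
  residual variance \<open>v\<close>, and its expected logarithm at \<open>X0\<close> is \<open>- (ln (2 \<pi> v) + 1) / 2\<close>. Hence a
  prediction earns half the logarithm of the ratio of the residual variances before and after it.
  As the prior becomes flat the ratio tends to \<open>(t + 1) / (t + 1 - q)\<close> for \<open>t < T\<close> and to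
  \<open>1 / (1 - q)\<close> for the first prediction \<open>t = T\<close>. Gauss's product for the Gamma function gives the
  asymptotics of the resulting sum.
\<close>

section \<open>Independence of uncorrelated Gaussian combinations\<close>

text \<open>No density of a Gaussian vector of dimension above two is ever formed: that uncorrelated
  combinations are independent is reduced, one source at a time, to a rotation of two independent
  Gaussians. The market densities \<open>hm\<close> and \<open>hp\<close> are arbitrary versions of
  conditional densities, fixed only almost everywhere, yet they are evaluated at the random point
  \<open>X0\<close>. This is harmless because the joint law of the public information and
  \<open>X0\<close> is absolutely continuous with respect to the law of the information times
  Lebesgue measure, so two versions agree almost surely along \<open>X0\<close>. For a finite prior
  variance the flat-prior regression weights are merely multiplied by a shrinkage factor, so every
  posterior variance has the form \<open>\<sigma>\<^sup>2 * w / (\<sigma>\<^sup>2 + w)\<close> with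
  \<open>w\<close> its flat-prior value, and the limit is taken in finitely many explicit terms. The
  posterior after a prediction depends on one signal only, the one before it on at most
  three.\<close>

lemma normal_density_mult_rotate:
  fixes a b :: real
  assumes [arith]: "0 < a" "0 < b"
  defines "k \<equiv> a\<^sup>2 / (a\<^sup>2 + b\<^sup>2)"
  shows "normal_density 0 a (r + k * s) * normal_density 0 b (s - (r + k * s)) =
    normal_density 0 (sqrt (a\<^sup>2 + b\<^sup>2)) s * normal_density 0 (sqrt (a\<^sup>2 * b\<^sup>2 / (a\<^sup>2 + b\<^sup>2))) r"
proof -
  define a' b' where "a' = a\<^sup>2" and "b' = b\<^sup>2"
  have pos [arith]: "0 < a'" "0 < b'"
    by (simp_all add: a'_def b'_def)
  have k: "k = a' / (a' + b')"
    by (simp add: k_def a'_def b'_def)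
  have sqrt: "sqrt (2 * pi * a') * sqrt (2 * pi * b') =
      sqrt (2 * pi * (a' + b')) * sqrt (2 * pi * (a' * b' / (a' + b')))"
    by (subst real_sqrt_mult[symmetric])+ (simp add: field_simps)
  \<comment> \<open>Completing the square: since \<open>k\<close> is the regression coefficient of
    the first variable on the sum, the cross term in \<open>r\<close> and \<open>s\<close>
    vanishes.\<close>
  have exponent: "- (r + k * s)\<^sup>2 / (2 * a') + - (s - (r + k * s))\<^sup>2 / (2 * b') =
      - s\<^sup>2 / (2 * (a' + b')) + - r\<^sup>2 / (2 * (a' * b' / (a' + b')))"
  proof -
    have sk: "s - k * s = (b' / (a' + b')) * s"
      unfolding k by (simp add: field_simps)
    have e: "s - (r + k * s) = (b' / (a' + b')) * s - r"
      using sk by simp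
    have "- (r + k * s)\<^sup>2 / (2 * a') + - (s - (r + k * s))\<^sup>2 / (2 * b') =
       - (r + (a' / (a' + b')) * s)\<^sup>2 / (2 * a') + - ((b' / (a' + b')) * s - r)\<^sup>2 / (2 * b')"
      unfolding e by (simp add: k)
    also have "\<dots> = - s\<^sup>2 / (2 * (a' + b')) + - r\<^sup>2 / (2 * (a' * b' / (a' + b')))"
    proof -
      \<comment> \<open>Naming the sum keeps \<open>field_simps\<close> from expanding it as a
        denominator; its definition is used only once the denominators are cleared.\<close>
      define n where "n = a' + b'"
      have n: "n > 0" "a' = n - b'" by (simp_all add: n_def)
      have "a' \<noteq> 0" "b' \<noteq> 0" "n \<noteq> 0" using pos n by auto
      then have "(r + (a' / n) * s)\<^sup>2 / (2 * a') + ((b' / n) * s - r)\<^sup>2 / (2 * b') =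
         (r\<^sup>2 / a' + r\<^sup>2 / b' + s\<^sup>2 * (a' + b') / n\<^sup>2) / 2"
        by (simp add: field_simps power2_eq_square)
      also have "\<dots> = s\<^sup>2 / (2 * n) + r\<^sup>2 / (2 * (a' * b' / n))"
        unfolding n_def[symmetric] using \<open>a' \<noteq> 0\<close> \<open>b' \<noteq> 0\<close> \<open>n \<noteq> 0\<close>
        by (simp add: field_simps power2_eq_square) (simp add: n_def algebra_simps)
      finally show ?thesis
        unfolding n_def[symmetric] by simp
    qed
    finally show ?thesis .
  qed
  have "normal_density 0 a (r + k * s) * normal_density 0 b (s - (r + k * s)) =
     1 / (sqrt (2 * pi * a') * sqrt (2 * pi * b')) *
     exp (- (r + k * s)\<^sup>2 / (2 * a') + - (s - (r + k * s))\<^sup>2 / (2 * b'))"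
    unfolding normal_density_def a'_def b'_def by (subst exp_add) simp
  also have "\<dots> = 1 / (sqrt (2 * pi * (a' + b')) * sqrt (2 * pi * (a' * b' / (a' + b')))) *
     exp (- s\<^sup>2 / (2 * (a' + b')) + - r\<^sup>2 / (2 * (a' * b' / (a' + b'))))"
    unfolding sqrt exponent ..
  also have "\<dots> = normal_density 0 (sqrt (a' + b')) s * normal_density 0 (sqrt (a' * b' / (a' + b'))) r"
    unfolding normal_density_def by (subst exp_add) simp
  finally show ?thesis
    by (simp add: a'_def b'_def)
qed

text \<open>The map from \<open>(U, V)\<close> to the sum and the residual of \<open>U\<close> is a
  composition of two shears with unit Jacobian. Each is carried out as a translation of the inner
  integral, with an exchange of the integrals in between, and the transformed density is a
  product.\<close>

lemma (in prob_space) indep_var_normal_rotate: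
  fixes U V :: "'a \<Rightarrow> real"
  assumes a [arith]: "0 < a" and b [arith]: "0 < b"
    and U: "distributed M lborel U (normal_density 0 a)"
    and V: "distributed M lborel V (normal_density 0 b)"
    and UV: "indep_var borel U borel V"
  defines "k \<equiv> a\<^sup>2 / (a\<^sup>2 + b\<^sup>2)"
  shows "indep_var borel (\<lambda>\<omega>. U \<omega> + V \<omega>) borel (\<lambda>\<omega>. U \<omega> - k * (U \<omega> + V \<omega>))"
proof -
  let ?S = "\<lambda>\<omega>. U \<omega> + V \<omega>" and ?R = "\<lambda>\<omega>. U \<omega> - k * (U \<omega> + V \<omega>)"
  let ?c = "sqrt (a\<^sup>2 + b\<^sup>2)" and ?d = "sqrt (a\<^sup>2 * b\<^sup>2 / (a\<^sup>2 + b\<^sup>2))"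
  let ?N = "\<lambda>s. density lborel (\<lambda>x. ennreal (normal_density 0 s x))"
  have cd: "0 < ?c" "0 < ?d"
    by (auto intro!: add_pos_pos divide_pos_pos mult_pos_pos)
  interpret Nc: prob_space "?N ?c" by (rule prob_space_normal_density[OF cd(1)])
  interpret Nd: prob_space "?N ?d" by (rule prob_space_normal_density[OF cd(2)])
  have [measurable]: "U \<in> borel_measurable M" "V \<in> borel_measurable M"
    using U V by (simp_all add: distributed_def)
  have "indep_var lborel U lborel V"
    using indep_var_compose[OF UV, of "\<lambda>x. x" lborel "\<lambda>x. x" lborel] by (simp add: comp_def)
  then have J: "distributed M (lborel \<Otimes>\<^sub>M lborel) (\<lambda>x. (U x, V x))
      (\<lambda>(x, y). ennreal (normal_density 0 a x) * ennreal (normal_density 0 b y))"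
    by (intro distributed_joint_indep U V) (simp_all add: sigma_finite_lborel)
  have joint: "emeasure M (?S -` A \<inter> ?R -` B \<inter> space M) = emeasure (?N ?c) A * emeasure (?N ?d) B"
    if [measurable]: "A \<in> sets borel" "B \<in> sets borel" for A B
  proof -
    have "emeasure M (?S -` A \<inter> ?R -` B \<inter> space M) =
        (\<integral>\<^sup>+\<omega>. indicator A (?S \<omega>) * indicator B (?R \<omega>) \<partial>M)"
    proof -
      have "(\<lambda>\<omega>. (?S \<omega>, ?R \<omega>)) -` (A \<times> B) \<inter> space M \<in> sets M"
        by (rule measurable_sets[where A = "borel \<Otimes>\<^sub>M borel"]) auto
      also have "(\<lambda>\<omega>. (?S \<omega>, ?R \<omega>)) -` (A \<times> B) \<inter> space M = ?S -` A \<inter> ?R -` B \<inter> space M"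
        by auto
      finally show ?thesis
        by (subst nn_integral_indicator[symmetric], assumption)
           (rule nn_integral_cong, auto simp: indicator_def)
    qed
    also have "\<dots> = (\<integral>\<^sup>+z. (case z of (x, y) \<Rightarrow> ennreal (normal_density 0 a x) * ennreal (normal_density 0 b y)) *
        (case z of (x, y) \<Rightarrow> indicator A (x + y) * indicator B (x - k * (x + y))) \<partial>(lborel \<Otimes>\<^sub>M lborel))"
      by (subst distributed_nn_integral[OF J]) auto
    also have "\<dots> = (\<integral>\<^sup>+x. \<integral>\<^sup>+y. ennreal (normal_density 0 a x) * ennreal (normal_density 0 b y) *
        (indicator A (x + y) * indicator B (x - k * (x + y))) \<partial>lborel \<partial>lborel)"
      by (subst lborel.nn_integral_fst[symmetric]) auto
    also have "\<dots> = (\<integral>\<^sup>+x. \<integral>\<^sup>+s. ennreal (normal_density 0 a x) * ennreal (normal_density 0 b (s - x)) *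
        (indicator A s * indicator B (x - k * s)) \<partial>lborel \<partial>lborel)"
    proof (rule nn_integral_cong)
      fix x
      show "(\<integral>\<^sup>+y. ennreal (normal_density 0 a x) * ennreal (normal_density 0 b y) *
          (indicator A (x + y) * indicator B (x - k * (x + y))) \<partial>lborel) =
        (\<integral>\<^sup>+s. ennreal (normal_density 0 a x) * ennreal (normal_density 0 b (s - x)) *
          (indicator A s * indicator B (x - k * s)) \<partial>lborel)"
        by (subst (2) nn_integral_real_affine[where c = 1 and t = x]) auto
    qed
    also have "\<dots> = (\<integral>\<^sup>+s. \<integral>\<^sup>+x. ennreal (normal_density 0 a x) * ennreal (normal_density 0 b (s - x)) *
        (indicator A s * indicator B (x - k * s)) \<partial>lborel \<partial>lborel)"
      by (subst lborel_pair.Fubini') auto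
    also have "\<dots> = (\<integral>\<^sup>+s. \<integral>\<^sup>+r. ennreal (normal_density 0 a (r + k * s)) *
        ennreal (normal_density 0 b (s - (r + k * s))) *
        (indicator A s * indicator B r) \<partial>lborel \<partial>lborel)"
    proof (rule nn_integral_cong)
      fix s
      show "(\<integral>\<^sup>+x. ennreal (normal_density 0 a x) * ennreal (normal_density 0 b (s - x)) *
          (indicator A s * indicator B (x - k * s)) \<partial>lborel) =
        (\<integral>\<^sup>+r. ennreal (normal_density 0 a (r + k * s)) * ennreal (normal_density 0 b (s - (r + k * s))) *
          (indicator A s * indicator B r) \<partial>lborel)"
        by (subst nn_integral_real_affine[where c = 1 and t = "k * s"]) (auto simp: add.commute)
    qed
    also have "\<dots> = (\<integral>\<^sup>+s. \<integral>\<^sup>+r. (ennreal (normal_density 0 ?c s) * indicator A s) *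
        (ennreal (normal_density 0 ?d r) * indicator B r) \<partial>lborel \<partial>lborel)"
      unfolding ennreal_mult[symmetric, OF normal_density_nonneg normal_density_nonneg]
        normal_density_mult_rotate[OF a b, folded k_def]
      by (simp add: ennreal_mult ac_simps)
    also have "\<dots> = emeasure (?N ?c) A * emeasure (?N ?d) B"
      by (simp add: nn_integral_cmult nn_integral_multc emeasure_density)
    finally show ?thesis .
  qed
  \<comment> \<open>Taking the other set to be the whole line gives the marginals, so the rectangle
    formula says that the joint law is the product of the marginal laws.\<close>
  have S: "emeasure M (?S -` A \<inter> space M) = emeasure (?N ?c) A" if "A \<in> sets borel" for A
    using joint[OF that, of UNIV] Nd.emeasure_space_1 by (simp)
  have R: "emeasure M (?R -` B \<inter> space M) = emeasure (?N ?d) B" if "B \<in> sets borel" for B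
    using joint[OF _ that, of UNIV] Nc.emeasure_space_1 by (simp)
  show ?thesis
    unfolding indep_var_distribution_eq
  proof (intro conjI)
    interpret DS: prob_space "distr M borel ?S" by (rule prob_space_distr) simp
    interpret DR: prob_space "distr M borel ?R" by (rule prob_space_distr) simp
    interpret DSR: pair_sigma_finite "distr M borel ?S" "distr M borel ?R" ..
    show "distr M borel ?S \<Otimes>\<^sub>M distr M borel ?R = distr M (borel \<Otimes>\<^sub>M borel) (\<lambda>x. (?S x, ?R x))"
    proof (rule pair_measure_eqI)
      fix A B assume *: "A \<in> sets (distr M borel ?S)" "B \<in> sets (distr M borel ?R)"
      then have [measurable]: "A \<in> sets borel" "B \<in> sets borel" by auto
      have "(\<lambda>x. (?S x, ?R x)) -` (A \<times> B) \<inter> space M = ?S -` A \<inter> ?R -` B \<inter> space M"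
        by auto
      then show "emeasure (distr M borel ?S) A * emeasure (distr M borel ?R) B =
          emeasure (distr M (borel \<Otimes>\<^sub>M borel) (\<lambda>x. (?S x, ?R x))) (A \<times> B)"
        by (simp add: emeasure_distr S R joint)
    qed (auto intro: DS.sigma_finite_measure_axioms DR.sigma_finite_measure_axioms)
  qed auto
qed

text \<open>The library's \<open>indep_var\<close> forces both variables to have the same type; this is its
  heterogeneous version.\<close>
definition indep_rv :: "'a measure \<Rightarrow> 'b measure \<Rightarrow> ('a \<Rightarrow> 'b) \<Rightarrow> 'c measure \<Rightarrow> ('a \<Rightarrow> 'c) \<Rightarrow> bool" where
  "indep_rv M S X T Y \<longleftrightarrow> X \<in> measurable M S \<and> Y \<in> measurable M T \<and>
     distr M S X \<Otimes>\<^sub>M distr M T Y = distr M (S \<Otimes>\<^sub>M T) (\<lambda>\<omega>. (X \<omega>, Y \<omega>))"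

section \<open>Rules for independence of variables of different types\<close>

lemma (in prob_space) indep_var_imp_indep_rv: "indep_var S X T Y \<Longrightarrow> indep_rv M S X T Y"
  by (simp add: indep_var_distribution_eq indep_rv_def)

lemma (in prob_space) indep_rv_compose:
  assumes XY: "indep_rv M S X T Y" and f: "f \<in> measurable S S'" and g: "g \<in> measurable T T'"
  shows "indep_rv M S' (\<lambda>\<omega>. f (X \<omega>)) T' (\<lambda>\<omega>. g (Y \<omega>))"
proof -
  have [measurable]: "X \<in> measurable M S" "Y \<in> measurable M T"
    using XY by (simp_all add: indep_rv_def)
  note [measurable] = f g
  have fX: "distr M S' (\<lambda>\<omega>. f (X \<omega>)) = distr (distr M S X) S' f"
    by (simp add: distr_distr comp_def)
  have gY: "distr M T' (\<lambda>\<omega>. g (Y \<omega>)) = distr (distr M T Y) T' g"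
    by (simp add: distr_distr comp_def)
  interpret DY: prob_space "distr (distr M T Y) T' g"
    unfolding gY[symmetric] by (rule prob_space_distr) simp
  have "distr (distr M S X) S' f \<Otimes>\<^sub>M distr (distr M T Y) T' g =
      distr (distr M S X \<Otimes>\<^sub>M distr M T Y) (S' \<Otimes>\<^sub>M T') (\<lambda>(x, y). (f x, g y))"
    by (rule pair_measure_distr) (auto intro: DY.sigma_finite_measure_axioms)
  also have "\<dots> = distr M (S' \<Otimes>\<^sub>M T') (\<lambda>\<omega>. (f (X \<omega>), g (Y \<omega>)))"
    using XY by (simp add: indep_rv_def distr_distr comp_def)
  finally show ?thesis
    by (simp add: indep_rv_def fX gY)
qed

lemma (in prob_space) indep_rv_swap:
  assumes XY: "indep_rv M S X T Y"
  shows "indep_rv M T Y S X"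
proof -
  have [measurable]: "X \<in> measurable M S" "Y \<in> measurable M T"
    using XY by (simp_all add: indep_rv_def)
  interpret DX: prob_space "distr M S X" by (rule prob_space_distr) simp
  interpret DY: prob_space "distr M T Y" by (rule prob_space_distr) simp
  interpret DYX: pair_sigma_finite "distr M T Y" "distr M S X" ..
  have "distr M T Y \<Otimes>\<^sub>M distr M S X =
      distr (distr M S X \<Otimes>\<^sub>M distr M T Y) (distr M T Y \<Otimes>\<^sub>M distr M S X) (\<lambda>(x, y). (y, x))"
    by (rule DYX.distr_pair_swap)
  also have "\<dots> = distr (distr M S X \<Otimes>\<^sub>M distr M T Y) (T \<Otimes>\<^sub>M S) (\<lambda>(x, y). (y, x))"
    by (intro distr_cong) (simp_all cong: sets_pair_measure_cong)
  also have "\<dots> = distr M (T \<Otimes>\<^sub>M S) (\<lambda>\<omega>. (Y \<omega>, X \<omega>))"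
    using XY by (simp add: indep_rv_def distr_distr comp_def)
  finally show ?thesis
    by (simp add: indep_rv_def)
qed

text \<open>Together the hypotheses make \<open>P\<close>, \<open>Q\<close> and \<open>R\<close>
  mutually independent; the grouping changes by exchanging the integrals over \<open>P\<close> and
  \<open>R\<close>. The induction on the sources uses this to move a variable from one side to the
  other.\<close>

lemma (in prob_space) indep_rv_assoc:
  assumes R_PQ: "indep_rv M N R (N1 \<Otimes>\<^sub>M N2) (\<lambda>\<omega>. (P \<omega>, Q \<omega>))"
    and PQ: "indep_rv M N1 P N2 Q"
  shows "indep_rv M N1 P (N \<Otimes>\<^sub>M N2) (\<lambda>\<omega>. (R \<omega>, Q \<omega>))"
proof -
  have [measurable]: "R \<in> measurable M N" "P \<in> measurable M N1" "Q \<in> measurable M N2"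
    using R_PQ PQ by (simp_all add: indep_rv_def)
  interpret DR: prob_space "distr M N R" by (rule prob_space_distr) simp
  interpret DP: prob_space "distr M N1 P" by (rule prob_space_distr) simp
  interpret DQ: prob_space "distr M N2 Q" by (rule prob_space_distr) simp
  have "indep_rv M N R N2 Q"
    using indep_rv_compose[OF R_PQ measurable_ident measurable_snd] by simp
  then have RQ: "distr M (N \<Otimes>\<^sub>M N2) (\<lambda>\<omega>. (R \<omega>, Q \<omega>)) = distr M N R \<Otimes>\<^sub>M distr M N2 Q"
    by (simp add: indep_rv_def)
  interpret RQ: pair_prob_space "distr M N R" "distr M N2 Q" ..
  interpret PQ': pair_prob_space "distr M N1 P" "distr M N2 Q" ..
  interpret P_RQ: pair_prob_space "distr M N1 P" "distr M N R \<Otimes>\<^sub>M distr M N2 Q" ..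
  interpret R_PQ': pair_prob_space "distr M N R" "distr M N1 P \<Otimes>\<^sub>M distr M N2 Q" ..
  interpret RP: pair_prob_space "distr M N R" "distr M N1 P" ..
  have R_PQ_distr: "distr M (N \<Otimes>\<^sub>M (N1 \<Otimes>\<^sub>M N2)) (\<lambda>\<omega>. (R \<omega>, P \<omega>, Q \<omega>)) =
      distr M N R \<Otimes>\<^sub>M (distr M N1 P \<Otimes>\<^sub>M distr M N2 Q)"
    using R_PQ PQ by (simp add: indep_rv_def)
  show ?thesis
    unfolding indep_rv_def RQ
  proof (intro conjI)
    show "distr M N1 P \<Otimes>\<^sub>M (distr M N R \<Otimes>\<^sub>M distr M N2 Q) =
        distr M (N1 \<Otimes>\<^sub>M (N \<Otimes>\<^sub>M N2)) (\<lambda>x. (P x, R x, Q x))"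
    proof (rule measure_eqI)
      fix C assume "C \<in> sets (distr M N1 P \<Otimes>\<^sub>M (distr M N R \<Otimes>\<^sub>M distr M N2 Q))"
      then have C [measurable]: "C \<in> sets (N1 \<Otimes>\<^sub>M (N \<Otimes>\<^sub>M N2))"
        by (simp cong: sets_pair_measure_cong)
      have "emeasure (distr M N1 P \<Otimes>\<^sub>M (distr M N R \<Otimes>\<^sub>M distr M N2 Q)) C =
          (\<integral>\<^sup>+p. \<integral>\<^sup>+r. \<integral>\<^sup>+q. indicator C (p, r, q) \<partial>distr M N2 Q \<partial>distr M N R \<partial>distr M N1 P)"
        by (subst RQ.P.emeasure_pair_measure, simp cong: sets_pair_measure_cong)
           (intro nn_integral_cong, subst DQ.nn_integral_fst[symmetric], auto)
      also have "\<dots> = (\<integral>\<^sup>+r. \<integral>\<^sup>+p. \<integral>\<^sup>+q. indicator C (p, r, q) \<partial>distr M N2 Q \<partial>distr M N1 P \<partial>distr M N R)"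
        by (rule RP.Fubini') measurable
      also have "\<dots> = (\<integral>\<^sup>+z. indicator C (fst (snd z), fst z, snd (snd z))
            \<partial>(distr M N R \<Otimes>\<^sub>M (distr M N1 P \<Otimes>\<^sub>M distr M N2 Q)))"
        by (subst PQ'.P.nn_integral_fst[symmetric], measurable)
           (intro nn_integral_cong, subst DQ.nn_integral_fst[symmetric], auto)
      also have "\<dots> = (\<integral>\<^sup>+\<omega>. indicator C (P \<omega>, R \<omega>, Q \<omega>) \<partial>M)"
        unfolding R_PQ_distr[symmetric] by (subst nn_integral_distr) auto
      also have "\<dots> = emeasure (distr M (N1 \<Otimes>\<^sub>M (N \<Otimes>\<^sub>M N2)) (\<lambda>x. (P x, R x, Q x))) C"
        by (subst nn_integral_indicator[symmetric], simp, subst nn_integral_distr) auto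
      finally show "emeasure (distr M N1 P \<Otimes>\<^sub>M (distr M N R \<Otimes>\<^sub>M distr M N2 Q)) C =
          emeasure (distr M (N1 \<Otimes>\<^sub>M (N \<Otimes>\<^sub>M N2)) (\<lambda>x. (P x, R x, Q x))) C" .
    qed (simp cong: sets_pair_measure_cong)
  qed auto
qed

text \<open>Sources with coefficient zero are dropped first, since a multiple by zero has no
  density. The index \<open>i\<close> guarantees that something is left.\<close>

lemma (in prob_space) distributed_linear_combination_normal:
  fixes Z :: "'i \<Rightarrow> 'a \<Rightarrow> real"
  assumes I: "finite I" "i \<in> I" "c i \<noteq> 0"
    and indep: "indep_vars (\<lambda>_. borel) Z I"
    and s: "\<And>i. i \<in> I \<Longrightarrow> 0 < s i"
    and Z: "\<And>i. i \<in> I \<Longrightarrow> distributed M lborel (Z i) (normal_density 0 (s i))"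
  shows "distributed M lborel (\<lambda>\<omega>. \<Sum>i\<in>I. c i * Z i \<omega>)
    (normal_density 0 (sqrt (\<Sum>i\<in>I. (c i)\<^sup>2 * (s i)\<^sup>2)))"
proof -
  let ?J = "{i \<in> I. c i \<noteq> 0}"
  have "distributed M lborel (\<lambda>\<omega>. 0 + c i * Z i \<omega>) (normal_density (0 + c i * 0) (\<bar>c i\<bar> * s i))"
    if "i \<in> ?J" for i
    using that by (intro normal_density_affine Z s) auto
  moreover have "indep_vars (\<lambda>_. borel) (\<lambda>i \<omega>. c i * Z i \<omega>) ?J"
    by (rule indep_vars_compose2[OF indep_vars_subset[OF indep]]) auto
  ultimately have "distributed M lborel (\<lambda>\<omega>. \<Sum>i\<in>?J. c i * Z i \<omega>)
      (normal_density (\<Sum>i\<in>?J. 0) (sqrt (\<Sum>i\<in>?J. (\<bar>c i\<bar> * s i)\<^sup>2)))"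
    using I s by (intro sum_indep_normal) auto
  moreover have "(\<Sum>i\<in>?J. c i * Z i \<omega>) = (\<Sum>i\<in>I. c i * Z i \<omega>)" for \<omega>
    using I by (intro sum.mono_neutral_left) auto
  moreover have "(\<Sum>i\<in>?J. (\<bar>c i\<bar> * s i)\<^sup>2) = (\<Sum>i\<in>I. (c i)\<^sup>2 * (s i)\<^sup>2)"
    using I by (subst sum.mono_neutral_left[of I ?J]) (auto simp: power_mult_distrib)
  ultimately show ?thesis
    by simp
qed

text \<open>Base case of the induction below: with a single source the residual is identically
  zero.\<close>

lemma (in prob_space) indep_rv_const:
  assumes [measurable]: "X \<in> measurable M S" and t: "t \<in> space T"
  shows "indep_rv M S X T (\<lambda>_. t)"
proof -
  have [measurable]: "(\<lambda>_. t) \<in> measurable M T"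
    using t by simp
  interpret DX: prob_space "distr M S X" by (rule prob_space_distr) simp
  interpret Dt: prob_space "distr M T (\<lambda>_. t)" by (rule prob_space_distr) simp
  have "distr M S X \<Otimes>\<^sub>M distr M T (\<lambda>_. t) = distr M (S \<Otimes>\<^sub>M T) (\<lambda>\<omega>. (X \<omega>, t))"
  proof (rule pair_measure_eqI)
    fix A B assume "A \<in> sets (distr M S X)" "B \<in> sets (distr M T (\<lambda>_. t))"
    then have [measurable]: "A \<in> sets S" "B \<in> sets T"
      by auto
    have "(\<lambda>\<omega>. (X \<omega>, t)) -` (A \<times> B) = (if t \<in> B then X -` A else {})"
      by auto
    then show "emeasure (distr M S X) A * emeasure (distr M T (\<lambda>_. t)) B =
        emeasure (distr M (S \<Otimes>\<^sub>M T) (\<lambda>\<omega>. (X \<omega>, t))) (A \<times> B)"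
      by (simp add: emeasure_distr emeasure_space_1)
  qed (auto intro: DX.sigma_finite_measure_axioms Dt.sigma_finite_measure_axioms)
  then show ?thesis
    by (simp add: indep_rv_def)
qed

text \<open>The covariance of \<open>Z i\<close> with the combination is
  \<open>c i * (s i)\<^sup>2\<close>, so the vector consists of the residuals of all sources after
  regression on it. Sources are added one at a time; \<open>j\<close> stays outside \<open>I\<close>
  so that the variance of the combination is positive at every stage.\<close>

lemma (in prob_space) indep_rv_linear_combination_residuals:
  fixes Z :: "'i \<Rightarrow> 'a \<Rightarrow> real"
  assumes "finite I" "j \<notin> I" "c j \<noteq> 0"
    and "indep_vars (\<lambda>_. borel) Z (insert j I)"
    and "\<And>i. i \<in> insert j I \<Longrightarrow> 0 < s i"
    and "\<And>i. i \<in> insert j I \<Longrightarrow> distributed M lborel (Z i) (normal_density 0 (s i))"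
  shows "indep_rv M borel (\<lambda>\<omega>. \<Sum>i\<in>insert j I. c i * Z i \<omega>) (PiM (insert j I) (\<lambda>_. borel))
    (\<lambda>\<omega>. \<lambda>i\<in>insert j I. Z i \<omega> - c i * (s i)\<^sup>2 / (\<Sum>i\<in>insert j I. (c i)\<^sup>2 * (s i)\<^sup>2) *
       (\<Sum>i\<in>insert j I. c i * Z i \<omega>))"
  using assms
proof (induction I rule: finite_induct)
  case empty
  have [measurable]: "Z j \<in> borel_measurable M"
    using empty.prems(5)[of j] by (simp add: distributed_def)
  have "s j \<noteq> 0"
    using empty.prems(4)[of j] by simp
  have res: "(\<lambda>\<omega>. \<lambda>i\<in>{j}. Z i \<omega> - c i * (s i)\<^sup>2 / (\<Sum>i\<in>{j}. (c i)\<^sup>2 * (s i)\<^sup>2) *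
       (\<Sum>i\<in>{j}. c i * Z i \<omega>)) = (\<lambda>\<omega>. \<lambda>i\<in>{j}. 0)"
    using \<open>s j \<noteq> 0\<close> \<open>c j \<noteq> 0\<close> by (auto simp: fun_eq_iff restrict_def power2_eq_square)
  show ?case
    unfolding res by (rule indep_rv_const) (auto simp: space_PiM)
next
  case (insert n I)
  define K where "K = insert j I"
  have K: "finite K" "n \<notin> K" "j \<in> K" "insert j (insert n I) = insert n K"
    using insert by (auto simp: K_def)
  define v where "v = (\<Sum>i\<in>K. (c i)\<^sup>2 * (s i)\<^sup>2)"
  define L where "L = (\<lambda>\<omega>. \<Sum>i\<in>K. c i * Z i \<omega>)"
  define R where "R = (\<lambda>\<omega>. \<lambda>i\<in>K. Z i \<omega> - c i * (s i)\<^sup>2 / v * L \<omega>)"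
  let ?P = "PiM K (\<lambda>_. borel) :: ('i \<Rightarrow> real) measure"
  have indep: "indep_vars (\<lambda>_. borel) Z (insert n K)"
    using insert.prems(3) K(4) by simp
  have s: "0 < s i" and Z: "distributed M lborel (Z i) (normal_density 0 (s i))" if "i \<in> insert n K" for i
    using that K(4) insert.prems by auto
  have [measurable]: "Z i \<in> borel_measurable M" if "i \<in> insert n K" for i
    using Z[OF that] by (simp add: distributed_def)
  have "(c j)\<^sup>2 * (s j)\<^sup>2 \<le> v"
    unfolding v_def using K by (intro member_le_sum) auto
  moreover have "0 < (c j)\<^sup>2 * (s j)\<^sup>2"
    using s[of j] \<open>c j \<noteq> 0\<close> K by auto
  ultimately have v: "0 < v"
    by linarith
  have LR: "indep_rv M borel L ?P R"
    unfolding R_def L_def v_def K_def using insert.prems indep_vars_subset[OF indep, of K]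
    by (intro insert.IH) (auto simp: K_def)
  have "indep_rv M (PiM {n} (\<lambda>_. borel)) (\<lambda>\<omega>. restrict (\<lambda>i. Z i \<omega>) {n})
      ?P (\<lambda>\<omega>. restrict (\<lambda>i. Z i \<omega>) K)"
    using K by (intro indep_var_imp_indep_rv indep_var_restrict[OF indep]) auto
  from indep_rv_compose[OF this, of "\<lambda>x. x n" borel "\<lambda>z. (\<Sum>i\<in>K. c i * z i,
      \<lambda>i\<in>K. z i - c i * (s i)\<^sup>2 / v * (\<Sum>i\<in>K. c i * z i))" "borel \<Otimes>\<^sub>M ?P"]
  have Zn_LR: "indep_rv M borel (Z n) (borel \<Otimes>\<^sub>M ?P) (\<lambda>\<omega>. (L \<omega>, R \<omega>))"
    by (simp add: R_def L_def cong: sum.cong restrict_cong)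
  from indep_rv_assoc[OF this LR]
  have L_ZnR: "indep_rv M borel L (borel \<Otimes>\<^sub>M ?P) (\<lambda>\<omega>. (Z n \<omega>, R \<omega>))" .
  show ?case
  proof (cases "c n = 0") \<comment> \<open>otherwise \<open>(L, c n * Z n)\<close> is rotated into the new combination and an
      independent \<open>\<rho>\<close>, and the new residuals are functions of the old ones and \<open>\<rho>\<close>\<close>
    case True
    \<comment> \<open>With \<open>c n = 0\<close> neither the combination nor its variance changes,
      and the residual of the new source is the source itself.\<close>
    let ?g = "\<lambda>(z, r). \<lambda>i\<in>insert n K. if i = n then z else r i"
    have g: "?g \<in> measurable (borel \<Otimes>\<^sub>M ?P) (PiM (insert n K) (\<lambda>_. borel))"
      unfolding split_beta' by (intro measurable_restrict) auto
    have eq: "(\<lambda>i\<in>insert n K. if i = n then Z n \<omega> else R \<omega> i) =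
       (\<lambda>i\<in>insert n K. Z i \<omega> - c i * (s i)\<^sup>2 / v * L \<omega>)" for \<omega>
      using True by (intro restrict_ext) (auto simp: R_def)
    have sums: "(\<Sum>i\<in>insert n K. c i * Z i \<omega>) = L \<omega>" "(\<Sum>i\<in>insert n K. (c i)\<^sup>2 * (s i)\<^sup>2) = v" for \<omega>
      using True K by (simp_all add: L_def v_def)
    show ?thesis
      using indep_rv_compose[OF L_ZnR measurable_ident g]
      by (simp only: K(4) sums eq prod.case id_apply)
  next
    case False
    let ?a = "sqrt v" and ?b = "\<bar>c n\<bar> * s n"
    let ?k = "?a\<^sup>2 / (?a\<^sup>2 + ?b\<^sup>2)"
    let ?S = "\<lambda>\<omega>. L \<omega> + c n * Z n \<omega>"
    let ?\<rho> = "\<lambda>\<omega>. L \<omega> - ?k * ?S \<omega>"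
    \<comment> \<open>Regrouping makes \<open>R\<close> independent of the pair
      \<open>(Z n, L)\<close>, hence of \<open>(?S, ?\<rho>)\<close>; once \<open>?S\<close> and
      \<open>?\<rho>\<close> are known to be independent, a second regrouping isolates
      \<open>?S\<close>.\<close>
    have "indep_rv M borel (Z n) (?P \<Otimes>\<^sub>M borel) (\<lambda>\<omega>. (R \<omega>, L \<omega>))"
      using indep_rv_compose[OF Zn_LR measurable_ident, of "\<lambda>(l, r). (r, l)" "?P \<Otimes>\<^sub>M borel"] by simp
    from indep_rv_assoc[OF this indep_rv_swap[OF LR]]
    have "indep_rv M ?P R (borel \<Otimes>\<^sub>M borel) (\<lambda>\<omega>. (Z n \<omega>, L \<omega>))" .
    from indep_rv_compose[OF this measurable_ident, of
        "\<lambda>(z, l). (l + c n * z, l - ?k * (l + c n * z))" "borel \<Otimes>\<^sub>M borel"]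
    have R_S\<rho>: "indep_rv M ?P R (borel \<Otimes>\<^sub>M borel) (\<lambda>\<omega>. (?S \<omega>, ?\<rho> \<omega>))"
      by simp
    have "indep_rv M borel L borel (\<lambda>\<omega>. c n * Z n \<omega>)"
      using indep_rv_compose[OF L_ZnR measurable_ident, of "\<lambda>(z, r). c n * z" borel] by simp
    then have "indep_var borel L borel (\<lambda>\<omega>. c n * Z n \<omega>)"
      by (simp add: indep_rv_def indep_var_distribution_eq)
    moreover have "distributed M lborel L (normal_density 0 ?a)"
      unfolding L_def v_def using K \<open>c j \<noteq> 0\<close> s Z by (intro distributed_linear_combination_normal[of K j]) (auto intro: indep_vars_subset[OF indep])
    moreover have "distributed M lborel (\<lambda>\<omega>. c n * Z n \<omega>) (normal_density 0 ?b)"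
      using normal_density_affine[OF Z s False, of n 0] by simp
    ultimately have "indep_var borel ?S borel ?\<rho>"
      using v s[of n] False by (intro indep_var_normal_rotate) auto
    from indep_rv_assoc[OF R_S\<rho> indep_var_imp_indep_rv[OF this]]
    have S_R\<rho>: "indep_rv M borel ?S (?P \<Otimes>\<^sub>M borel) (\<lambda>\<omega>. (R \<omega>, ?\<rho> \<omega>))" .
    let ?v' = "v + (c n)\<^sup>2 * (s n)\<^sup>2"
    have v': "0 < ?v'"
      using v by (intro add_pos_nonneg) auto
    have k: "?k = v / ?v'"
      using v by (simp add: power_mult_distrib)
    \<comment> \<open>The residuals of \<open>L\<close> and \<open>c n * Z n\<close> on their sum
      \<open>?S\<close> add up to zero, so the latter is \<open>- ?\<rho>\<close>. For an old
      source, adding the multiple of \<open>?\<rho>\<close> replaces the regression on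
      \<open>L\<close> by the one on \<open>?S\<close>, because
      \<open>?k / v = 1 / ?v'\<close>.\<close>
    have eq: "(\<lambda>i\<in>insert n K. if i = n then - ?\<rho> \<omega> / c n else R \<omega> i + c i * (s i)\<^sup>2 / v * ?\<rho> \<omega>) =
        (\<lambda>i\<in>insert n K. Z i \<omega> - c i * (s i)\<^sup>2 / ?v' * ?S \<omega>)" for \<omega>
    proof (rule restrict_ext)
      fix i assume "i \<in> insert n K"
      show "(if i = n then - ?\<rho> \<omega> / c n else R \<omega> i + c i * (s i)\<^sup>2 / v * ?\<rho> \<omega>) =
         Z i \<omega> - c i * (s i)\<^sup>2 / ?v' * ?S \<omega>"
      proof (cases "i = n")
        case True
        define e where "e = v / ?v'"
        have "(c n)\<^sup>2 * (s n)\<^sup>2 / ?v' = 1 - e"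
          using v' by (simp add: e_def field_simps)
        moreover have "c n * (Z n \<omega> - c n * (s n)\<^sup>2 / ?v' * ?S \<omega>) =
            c n * Z n \<omega> - ((c n)\<^sup>2 * (s n)\<^sup>2 / ?v') * ?S \<omega>"
          by (simp add: right_diff_distrib power2_eq_square ac_simps)
        ultimately have "- ?\<rho> \<omega> = c n * (Z n \<omega> - c n * (s n)\<^sup>2 / ?v' * ?S \<omega>)"
          unfolding k e_def[symmetric] by (simp add: left_diff_distrib)
        with True \<open>c n \<noteq> 0\<close> show ?thesis
          by simp
      next
        case False
        have "c i * (s i)\<^sup>2 / v * ?\<rho> \<omega> = c i * (s i)\<^sup>2 / v * L \<omega> - c i * (s i)\<^sup>2 / ?v' * ?S \<omega>"
          unfolding k using v by (simp add: right_diff_distrib)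
        with False \<open>i \<in> insert n K\<close> show ?thesis
          by (simp add: R_def)
      qed
    qed
    let ?g = "\<lambda>(r, \<rho>). \<lambda>i\<in>insert n K. if i = n then - \<rho> / c n else r i + c i * (s i)\<^sup>2 / v * \<rho>"
    have g: "?g \<in> measurable (?P \<Otimes>\<^sub>M borel) (PiM (insert n K) (\<lambda>_. borel))"
      unfolding split_beta' by (intro measurable_restrict) auto
    have sums: "(\<Sum>i\<in>insert n K. c i * Z i \<omega>) = ?S \<omega>" "(\<Sum>i\<in>insert n K. (c i)\<^sup>2 * (s i)\<^sup>2) = ?v'" for \<omega>
      using K by (simp_all add: L_def v_def)
    show ?thesis
      using indep_rv_compose[OF S_R\<rho> measurable_ident g]
      by (simp only: K(4) sums eq prod.case id_apply)
  qed
qed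

text \<open>A sigma-algebra enters \<open>indep_rv\<close> through the identity map into it. The
  hypothesis \<open>sub\<close> puts \<open>F\<close> inside the sigma-algebra generated by
  \<open>Y\<close>, so rectangles over \<open>F\<close> are preimages of rectangles over
  \<open>T\<close>.\<close>

lemma (in prob_space) indep_rv_sub_sigma:
  assumes XY: "indep_rv M S X T Y" and F: "subalgebra M F"
    and sub: "\<And>E. E \<in> sets F \<Longrightarrow> \<exists>C\<in>sets T. E = Y -` C \<inter> space M"
  shows "indep_rv M F (\<lambda>\<omega>. \<omega>) S X"
proof -
  have [measurable]: "X \<in> measurable M S" "Y \<in> measurable M T"
    using XY by (simp_all add: indep_rv_def)
  have id [measurable]: "(\<lambda>\<omega>. \<omega>) \<in> measurable M F"
    by (rule measurable_from_subalg[OF F]) simp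
  interpret DX: prob_space "distr M S X" by (rule prob_space_distr) simp
  interpret DY: prob_space "distr M T Y" by (rule prob_space_distr) simp
  interpret DF: prob_space "distr M F (\<lambda>\<omega>. \<omega>)" by (rule prob_space_distr) simp
  interpret DXY: pair_prob_space "distr M S X" "distr M T Y" ..
  have "distr M F (\<lambda>\<omega>. \<omega>) \<Otimes>\<^sub>M distr M S X = distr M (F \<Otimes>\<^sub>M S) (\<lambda>\<omega>. (\<omega>, X \<omega>))"
  proof (rule pair_measure_eqI)
    fix E A assume "E \<in> sets (distr M F (\<lambda>\<omega>. \<omega>))" "A \<in> sets (distr M S X)"
    then have [measurable]: "A \<in> sets S" and E [measurable]: "E \<in> sets F"
      by auto
    from sub[OF E] obtain C where [measurable]: "C \<in> sets T" and C: "E = Y -` C \<inter> space M"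
      by auto
    have "emeasure (distr M F (\<lambda>\<omega>. \<omega>)) E = emeasure M (Y -` C \<inter> space M)"
      by (subst emeasure_distr[OF id E]) (simp add: C Int_assoc)
    then have "emeasure (distr M F (\<lambda>\<omega>. \<omega>)) E * emeasure (distr M S X) A =
        emeasure (distr M S X) A * emeasure (distr M T Y) C"
      by (simp add: emeasure_distr mult.commute)
    also have "\<dots> = emeasure (distr M S X \<Otimes>\<^sub>M distr M T Y) (A \<times> C)"
      by (simp add: DY.emeasure_pair_measure_Times)
    also have "\<dots> = emeasure M ((\<lambda>\<omega>. (X \<omega>, Y \<omega>)) -` (A \<times> C) \<inter> space M)"
      using XY by (simp add: indep_rv_def emeasure_distr)
    also have "(\<lambda>\<omega>. (X \<omega>, Y \<omega>)) -` (A \<times> C) \<inter> space M = (\<lambda>\<omega>. (\<omega>, X \<omega>)) -` (E \<times> A) \<inter> space M"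
      using C by auto
    also have "emeasure M \<dots> = emeasure (distr M (F \<Otimes>\<^sub>M S) (\<lambda>\<omega>. (\<omega>, X \<omega>))) (E \<times> A)"
      by (simp add: emeasure_distr)
    finally show "emeasure (distr M F (\<lambda>\<omega>. \<omega>)) E * emeasure (distr M S X) A =
        emeasure (distr M (F \<Otimes>\<^sub>M S) (\<lambda>\<omega>. (\<omega>, X \<omega>))) (E \<times> A)" .
  qed (auto intro: DX.sigma_finite_measure_axioms DF.sigma_finite_measure_axioms)
  then show ?thesis
    by (simp add: indep_rv_def)
qed

section \<open>Sigma-algebras generated by families of signals\<close>

lemma space_gen_sigma [simp]: "space (gen_sigma M Y J) = space M"
  by (simp add: gen_sigma_def space_measure_of_conv)

lemma sets_gen_sigma:
  "sets (gen_sigma M Y J) = sigma_sets (space M) {Y i -` S \<inter> space M | i S. i \<in> J \<and> S \<in> sets borel}"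
  unfolding gen_sigma_def by (rule sets_measure_of) auto

lemma subalgebra_gen_sigma:
  assumes "\<And>j. j \<in> J \<Longrightarrow> Y j \<in> borel_measurable M"
  shows "subalgebra M (gen_sigma M Y J)"
  unfolding subalgebra_def sets_gen_sigma using assms
  by (auto intro!: sets.sigma_sets_subset)

lemma measurable_gen_sigma:
  assumes "j \<in> J"
  shows "Y j \<in> borel_measurable (gen_sigma M Y J)"
proof (rule measurableI)
  fix S :: "real set" assume "S \<in> sets borel"
  then show "Y j -` S \<inter> space (gen_sigma M Y J) \<in> sets (gen_sigma M Y J)"
    unfolding sets_gen_sigma space_gen_sigma using assms by (intro sigma_sets.Basic) blast
qed simp

text \<open>The preimages under \<open>R\<close> form a sigma-algebra that contains all
  generators.\<close>

lemma gen_sigma_vimage: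
  assumes R: "R \<in> measurable M T" and f: "\<And>j. j \<in> J \<Longrightarrow> f j \<in> borel_measurable T"
    and Y: "\<And>j \<omega>. j \<in> J \<Longrightarrow> \<omega> \<in> space M \<Longrightarrow> Y j \<omega> = f j (R \<omega>)"
    and E: "E \<in> sets (gen_sigma M Y J)"
  shows "\<exists>C\<in>sets T. E = R -` C \<inter> space M"
proof -
  let ?G = "vimage_algebra (space M) R T"
  have G: "sets ?G = {R -` A \<inter> space M | A. A \<in> sets T}"
    using R by (intro sets_vimage_algebra2) (auto dest: measurable_space)
  have "{Y i -` S \<inter> space M | i S. i \<in> J \<and> S \<in> sets borel} \<subseteq> sets ?G"
  proof clarify
    fix j and S :: "real set" assume j: "j \<in> J" and S: "S \<in> sets borel"
    have "Y j -` S \<inter> space M = R -` (f j -` S \<inter> space T) \<inter> space M"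
      using Y[OF j] measurable_space[OF R] by auto
    then show "Y j -` S \<inter> space M \<in> sets ?G"
      unfolding G using measurable_sets[OF f[OF j] S] by blast
  qed
  then have "sets (gen_sigma M Y J) \<subseteq> sets ?G"
    using sets.sigma_sets_subset[of _ ?G] by (simp add: sets_gen_sigma)
  then show ?thesis
    using E unfolding G by blast
qed

text \<open>Applying the coefficients of \<open>Y j\<close> to the residuals instead of the sources
  changes \<open>Y j\<close> by a term with the covariance as a factor, that is, not at all. So all
  the \<open>Y j\<close>, for any index set \<open>J\<close>, are functions of one vector that is
  independent of the combination.\<close>

lemma (in prob_space) indep_rv_uncorrelated_normal:
  fixes Z :: "'i \<Rightarrow> 'a \<Rightarrow> real"
  assumes I: "finite I" "i \<in> I" "c i \<noteq> 0"
    and indep: "indep_vars (\<lambda>_. borel) Z I"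
    and s: "\<And>i. i \<in> I \<Longrightarrow> 0 < s i"
    and Z: "\<And>i. i \<in> I \<Longrightarrow> distributed M lborel (Z i) (normal_density 0 (s i))"
    and Y: "\<And>j \<omega>. j \<in> J \<Longrightarrow> Y j \<omega> = (\<Sum>i\<in>I. d j i * Z i \<omega>)"
    and uncorrelated: "\<And>j. j \<in> J \<Longrightarrow> (\<Sum>i\<in>I. c i * d j i * (s i)\<^sup>2) = 0"
  shows "indep_rv M (gen_sigma M Y J) (\<lambda>\<omega>. \<omega>) borel (\<lambda>\<omega>. \<Sum>i\<in>I. c i * Z i \<omega>)"
proof -
  let ?L = "\<lambda>\<omega>. \<Sum>i\<in>I. c i * Z i \<omega>" and ?v = "\<Sum>i\<in>I. (c i)\<^sup>2 * (s i)\<^sup>2"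
  let ?R = "\<lambda>\<omega>. \<lambda>i\<in>I. Z i \<omega> - c i * (s i)\<^sup>2 / ?v * ?L \<omega>"
  have [measurable]: "Z i \<in> borel_measurable M" if "i \<in> I" for i
    using Z[OF that] by (simp add: distributed_def)
  have ins: "insert i (I - {i}) = I"
    using I by auto
  have LR: "indep_rv M borel ?L (PiM I (\<lambda>_. borel)) ?R"
    by (rule indep_rv_linear_combination_residuals[of "I - {i}" i c Z s, unfolded ins])
       (use I indep s Z in auto)
  then have R: "?R \<in> measurable M (PiM I (\<lambda>_. borel))"
    by (simp add: indep_rv_def)
  have YR: "Y j \<omega> = (\<Sum>i\<in>I. d j i * ?R \<omega> i)" if j: "j \<in> J" for j \<omega>
  proof -
    have "(\<Sum>i\<in>I. d j i * ?R \<omega> i) = (\<Sum>i\<in>I. d j i * Z i \<omega> - c i * d j i * (s i)\<^sup>2 * (?L \<omega> / ?v))"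
      by (intro sum.cong) (auto simp: algebra_simps)
    also have "\<dots> = Y j \<omega> - (\<Sum>i\<in>I. c i * d j i * (s i)\<^sup>2) * (?L \<omega> / ?v)"
      by (simp only: sum_subtractf sum_distrib_right Y[OF j])
    finally show ?thesis
      using uncorrelated[OF j] by simp
  qed
  have [measurable]: "Y j \<in> borel_measurable M" if "j \<in> J" for j
    using Y[OF that] by (subst measurable_cong) auto
  show ?thesis
  proof (rule indep_rv_sub_sigma[OF LR])
    show "subalgebra M (gen_sigma M Y J)"
      by (intro subalgebra_gen_sigma) simp
    show "\<exists>C\<in>sets (PiM I (\<lambda>_. borel)). E = ?R -` C \<inter> space M" if "E \<in> sets (gen_sigma M Y J)" for E
      using that by (rule gen_sigma_vimage[OF R, where f = "\<lambda>j r. \<Sum>i\<in>I. d j i * r i", rotated 2])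
        (auto simp: YR)
  qed
qed

section \<open>Normal conditional densities\<close>

text \<open>Given \<open>F\<close>, the mean \<open>m\<close> is frozen while \<open>L\<close> keeps
  its law; integrating over the product law of the identity into \<open>F\<close> and
  \<open>L\<close> makes this precise.\<close>

lemma (in prob_space) cond_density_normal:
  assumes F: "subalgebra M F" and indep: "indep_rv M F (\<lambda>\<omega>. \<omega>) borel L"
    and s: "0 < s" and L: "distributed M lborel L (normal_density 0 s)"
    and m [measurable]: "m \<in> borel_measurable F"
    and X: "\<And>\<omega>. \<omega> \<in> space M \<Longrightarrow> X \<omega> = m \<omega> + L \<omega>"
  shows "cond_density M F X (\<lambda>\<omega>. normal_density (m \<omega>) s)"
  unfolding cond_density_def
proof (intro conjI allI ballI)
  show "(\<lambda>(\<omega>, x). normal_density (m \<omega>) s x) \<in> borel_measurable (F \<Otimes>\<^sub>M borel)"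
    unfolding normal_density_def by measurable
  show "0 \<le> normal_density (m \<omega>) s x" for \<omega> x
    by simp
  fix E S assume E [measurable]: "E \<in> sets F" and S [measurable]: "S \<in> sets (borel :: real measure)"
  have id [measurable]: "(\<lambda>\<omega>. \<omega>) \<in> measurable M F"
    by (rule measurable_from_subalg[OF F]) simp
  have [measurable]: "L \<in> borel_measurable M"
    using L by (simp add: distributed_def)
  have [measurable]: "E \<in> sets M"
    using F E by (auto simp: subalgebra_def)
  have mM [measurable]: "m \<in> borel_measurable M"
    by (rule measurable_from_subalg[OF F m])
  have [measurable]: "X \<in> borel_measurable M"
    by (subst measurable_cong[OF X]) auto
  interpret DL: prob_space "distr M borel L" by (rule prob_space_distr) simp
  have DL: "distr M borel L = density lborel (\<lambda>x. ennreal (normal_density 0 s x))"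
    using L by (simp add: distributed_def cong: distr_cong)
  have "emeasure M (E \<inter> (X -` S \<inter> space M)) = (\<integral>\<^sup>+\<omega>. indicator E \<omega> * indicator S (m \<omega> + L \<omega>) \<partial>M)"
    by (subst nn_integral_indicator[symmetric], measurable)
       (rule nn_integral_cong, auto simp: indicator_def X)
  also have "\<dots> = (\<integral>\<^sup>+z. indicator E (fst z) * indicator S (m (fst z) + snd z) \<partial>distr M (F \<Otimes>\<^sub>M borel) (\<lambda>\<omega>. (\<omega>, L \<omega>)))"
    by (subst nn_integral_distr) auto
  also have "\<dots> = (\<integral>\<^sup>+z. indicator E (fst z) * indicator S (m (fst z) + snd z)
      \<partial>(distr M F (\<lambda>\<omega>. \<omega>) \<Otimes>\<^sub>M distr M borel L))"
    using indep by (simp add: indep_rv_def)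
  also have "\<dots> = (\<integral>\<^sup>+\<omega>. \<integral>\<^sup>+l. indicator E \<omega> * indicator S (m \<omega> + l) \<partial>distr M borel L \<partial>distr M F (\<lambda>\<omega>. \<omega>))"
    by (subst DL.nn_integral_fst[symmetric]) auto
  also have "\<dots> = (\<integral>\<^sup>+\<omega>. \<integral>\<^sup>+l. indicator E \<omega> * indicator S (m \<omega> + l) \<partial>distr M borel L \<partial>M)"
    by (subst nn_integral_distr) auto
  also have "\<dots> = (\<integral>\<^sup>+\<omega>\<in>E. (\<integral>\<^sup>+ x\<in>S. ennreal (normal_density (m \<omega>) s x) \<partial>lborel) \<partial>M)"
  proof (rule nn_integral_cong)
    fix \<omega>
    have "(\<integral>\<^sup>+l. indicator E \<omega> * indicator S (m \<omega> + l) \<partial>distr M borel L) =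
        indicator E \<omega> * (\<integral>\<^sup>+l. ennreal (normal_density 0 s l) * indicator S (m \<omega> + l) \<partial>lborel)"
      by (simp add: nn_integral_cmult DL nn_integral_density)
    also have "(\<integral>\<^sup>+l. ennreal (normal_density 0 s l) * indicator S (m \<omega> + l) \<partial>lborel) =
        (\<integral>\<^sup>+ x\<in>S. ennreal (normal_density (m \<omega>) s x) \<partial>lborel)"
      by (subst (2) nn_integral_real_affine[where c = 1 and t = "m \<omega>"]) (auto simp: normal_density_def)
    finally show "(\<integral>\<^sup>+l. indicator E \<omega> * indicator S (m \<omega> + l) \<partial>distr M borel L) =
        (\<integral>\<^sup>+ x\<in>S. ennreal (normal_density (m \<omega>) s x) \<partial>lborel) * indicator E \<omega>"
      by (simp add: mult.commute)
  qed
  finally show "emeasure M (E \<inter> (X -` S \<inter> space M)) =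
      (\<integral>\<^sup>+\<omega>\<in>E. (\<integral>\<^sup>+ x\<in>S. ennreal (normal_density (m \<omega>) s x) \<partial>lborel) \<partial>M)" .
qed

text \<open>The defining equation of \<open>cond_density\<close> fixes this law on rectangles, an
  intersection-stable generator. The reference measure restricts \<open>M\<close> to
  \<open>F\<close> to match the sigma-algebra of the law.\<close>

lemma (in prob_space) cond_density_distr:
  assumes F: "subalgebra M F" and X [measurable]: "X \<in> borel_measurable M"
    and h: "cond_density M F X h"
  shows "distr M (F \<Otimes>\<^sub>M borel) (\<lambda>\<omega>. (\<omega>, X \<omega>)) =
    density (restr_to_subalg M F \<Otimes>\<^sub>M lborel) (\<lambda>(\<omega>, x). ennreal (h \<omega> x))"
proof -
  have hm: "(\<lambda>(\<omega>, x). h \<omega> x) \<in> borel_measurable (F \<Otimes>\<^sub>M borel)"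
    using h by (simp add: cond_density_def)
  have sets_N: "sets (restr_to_subalg M F \<Otimes>\<^sub>M lborel) = sets (F \<Otimes>\<^sub>M borel)"
    using sets_restr_to_subalg[OF F] by (intro sets_pair_measure_cong) auto
  note [measurable_cong] = sets_N
  have [measurable]: "(\<lambda>(\<omega>, x). h \<omega> x) \<in> borel_measurable (F \<Otimes>\<^sub>M lborel)"
    using hm by (simp cong: measurable_cong_sets)
  have [measurable]: "(\<lambda>\<omega>. \<omega>) \<in> measurable M F"
    by (rule measurable_from_subalg[OF F]) simp
  have spaceF: "space F = space M"
    using F by (simp add: subalgebra_def)
  let ?E = "{a \<times> b | a b. a \<in> sets F \<and> b \<in> sets (borel :: real measure)}"
  show ?thesis
  proof (rule measure_eqI_generator_eq[where E = ?E and \<Omega> = "space F \<times> space borel" and A = "\<lambda>_. space F \<times> space borel"])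
    show "Int_stable ?E"
      by (rule Int_stable_pair_measure_generator)
    show "?E \<subseteq> Pow (space F \<times> space borel)"
      by (rule pair_measure_closed)
    show "sets (distr M (F \<Otimes>\<^sub>M borel) (\<lambda>\<omega>. (\<omega>, X \<omega>))) = sigma_sets (space F \<times> space borel) ?E"
      by (simp add: sets_pair_measure)
    show "sets (density (restr_to_subalg M F \<Otimes>\<^sub>M lborel) (\<lambda>(\<omega>, x). ennreal (h \<omega> x))) =
        sigma_sets (space F \<times> space borel) ?E"
      by (simp only: sets_density sets_N sets_pair_measure[of F borel])
    show "range (\<lambda>_::nat. space F \<times> space borel) \<subseteq> ?E"
      by blast
    show "emeasure (distr M (F \<Otimes>\<^sub>M borel) (\<lambda>\<omega>. (\<omega>, X \<omega>))) (space F \<times> space borel) \<noteq> \<infinity>"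
      by (simp add: emeasure_distr)
    fix C assume "C \<in> ?E"
    then obtain E S where C: "C = E \<times> S" and E [measurable]: "E \<in> sets F" and S [measurable]: "S \<in> sets borel"
      by auto
    have "(\<lambda>\<omega>. (\<omega>, X \<omega>)) -` (E \<times> S) \<inter> space M = E \<inter> (X -` S \<inter> space M)"
      by auto
    then have "emeasure (distr M (F \<Otimes>\<^sub>M borel) (\<lambda>\<omega>. (\<omega>, X \<omega>))) C = emeasure M (E \<inter> (X -` S \<inter> space M))"
      by (simp add: C emeasure_distr)
    also have "\<dots> = (\<integral>\<^sup>+ \<omega>\<in>E. (\<integral>\<^sup>+ x\<in>S. ennreal (h \<omega> x) \<partial>lborel) \<partial>M)"
      using h E S by (simp add: cond_density_def)
    also have "\<dots> = (\<integral>\<^sup>+ \<omega>. \<integral>\<^sup>+ x. ennreal (h \<omega> x) * indicator (E \<times> S) (\<omega>, x) \<partial>lborel \<partial>M)"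
    proof (rule nn_integral_cong)
      fix \<omega>
      show "(\<integral>\<^sup>+ x\<in>S. ennreal (h \<omega> x) \<partial>lborel) * indicator E \<omega> =
          (\<integral>\<^sup>+ x. ennreal (h \<omega> x) * indicator (E \<times> S) (\<omega>, x) \<partial>lborel)"
        by (cases "\<omega> \<in> E") (simp_all add: indicator_times)
    qed
    also have "\<dots> = (\<integral>\<^sup>+ \<omega>. \<integral>\<^sup>+ x. ennreal (h \<omega> x) * indicator (E \<times> S) (\<omega>, x) \<partial>lborel \<partial>restr_to_subalg M F)"
      by (rule nn_integral_subalgebra2[OF F, symmetric]) measurable
    also have "\<dots> = emeasure (density (restr_to_subalg M F \<Otimes>\<^sub>M lborel) (\<lambda>(\<omega>, x). ennreal (h \<omega> x))) C"
      by (subst emeasure_density) (auto simp: C lborel.nn_integral_fst[symmetric] sets_restr_to_subalg[OF F])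
    finally show "emeasure (distr M (F \<Otimes>\<^sub>M borel) (\<lambda>\<omega>. (\<omega>, X \<omega>))) C =
      emeasure (density (restr_to_subalg M F \<Otimes>\<^sub>M lborel) (\<lambda>(\<omega>, x). ennreal (h \<omega> x))) C" .
  qed simp
qed

text \<open>Both versions are densities of the same finite law, hence equal almost everywhere for
  the reference measure. This passes to the law of \<open>(\<omega>, X \<omega>)\<close>, which is
  absolutely continuous with respect to it, and so to evaluation at the random point.\<close>

lemma (in prob_space) cond_density_unique:
  assumes F: "subalgebra M F" and X [measurable]: "X \<in> borel_measurable M"
    and h: "cond_density M F X h" and g: "cond_density M F X g"
  shows "AE \<omega> in M. h \<omega> (X \<omega>) = g \<omega> (X \<omega>)"
proof -
  let ?N = "restr_to_subalg M F \<Otimes>\<^sub>M lborel :: ('a \<times> real) measure"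
  let ?D = "distr M (F \<Otimes>\<^sub>M borel) (\<lambda>\<omega>. (\<omega>, X \<omega>))"
  have [measurable_cong]: "sets ?N = sets (F \<Otimes>\<^sub>M borel)"
    using sets_restr_to_subalg[OF F] by (intro sets_pair_measure_cong) auto
  have [measurable]: "(\<lambda>(\<omega>, x). h \<omega> x) \<in> borel_measurable (F \<Otimes>\<^sub>M borel)"
    "(\<lambda>(\<omega>, x). g \<omega> x) \<in> borel_measurable (F \<Otimes>\<^sub>M borel)"
    using h g by (simp_all add: cond_density_def)
  have [measurable]: "(\<lambda>\<omega>. \<omega>) \<in> measurable M F"
    by (rule measurable_from_subalg[OF F]) simp
  interpret D: prob_space ?D by (rule prob_space_distr) simp
  note eq = cond_density_distr[OF F X h] cond_density_distr[OF F X g]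
  have "AE z in ?N. (case z of (\<omega>, x) \<Rightarrow> ennreal (h \<omega> x)) = (case z of (\<omega>, x) \<Rightarrow> ennreal (g \<omega> x))"
  proof (rule iffD1[OF sigma_finite_density_unique])
    show "sigma_finite_measure (density ?N (\<lambda>(\<omega>, x). ennreal (h \<omega> x)))"
      unfolding eq(1)[symmetric] by (rule D.sigma_finite_measure_axioms)
    show "density ?N (\<lambda>(\<omega>, x). ennreal (h \<omega> x)) = density ?N (\<lambda>(\<omega>, x). ennreal (g \<omega> x))"
      using eq by simp
  qed measurable
  then have "AE z in ?N. h (fst z) (snd z) = g (fst z) (snd z)"
    using h g by (auto simp: cond_density_def split_beta' elim!: eventually_mono)
  then have "AE z in density ?N (\<lambda>(\<omega>, x). ennreal (h \<omega> x)). h (fst z) (snd z) = g (fst z) (snd z)"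
    by (subst AE_density) auto
  then have "AE z in ?D. h (fst z) (snd z) = g (fst z) (snd z)"
    unfolding eq(1) .
  then show ?thesis
    by (subst (asm) AE_distr_iff) auto
qed

text \<open>The logarithm of the normal density at \<open>X\<close> is a constant minus
  \<open>L\<^sup>2 / (2 * s\<^sup>2)\<close>, and the subtracted term has expectation one
  half.\<close>

lemma (in prob_space) expected_log_cond_density_normal:
  assumes F: "subalgebra M F" and indep: "indep_rv M F (\<lambda>\<omega>. \<omega>) borel L"
    and s: "0 < s" and L: "distributed M lborel L (normal_density 0 s)"
    and m: "m \<in> borel_measurable F"
    and X: "\<And>\<omega>. \<omega> \<in> space M \<Longrightarrow> X \<omega> = m \<omega> + L \<omega>"
    and h: "cond_density M F X h"
  shows "integrable M (\<lambda>\<omega>. ln (h \<omega> (X \<omega>)))"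
    and "expectation (\<lambda>\<omega>. ln (h \<omega> (X \<omega>))) = - (ln (2 * pi * s\<^sup>2) + 1) / 2"
proof -
  have [measurable]: "(\<lambda>\<omega>. \<omega>) \<in> measurable M F"
    by (rule measurable_from_subalg[OF F]) simp
  have [measurable]: "L \<in> borel_measurable M"
    using L by (simp add: distributed_def)
  have [measurable]: "m \<in> borel_measurable M"
    by (rule measurable_from_subalg[OF F m])
  have [measurable]: "X \<in> borel_measurable M"
    by (subst measurable_cong[OF X]) auto
  have "(\<lambda>(\<omega>, x). h \<omega> x) \<in> borel_measurable (F \<Otimes>\<^sub>M borel)"
    using h by (simp add: cond_density_def)
  from measurable_compose[OF _ this, of "\<lambda>\<omega>. (\<omega>, X \<omega>)" M]
  have hX [measurable]: "(\<lambda>\<omega>. h \<omega> (X \<omega>)) \<in> borel_measurable M"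
    by simp
  let ?f = "\<lambda>\<omega>. - ln (2 * pi * s\<^sup>2) / 2 - (L \<omega>)\<^sup>2 / (2 * s\<^sup>2)"
  have "AE \<omega> in M. h \<omega> (X \<omega>) = normal_density (m \<omega>) s (X \<omega>)"
    by (rule cond_density_unique[OF F _ h cond_density_normal[OF F indep s L m X]]) simp_all
  then have AE: "AE \<omega> in M. ln (h \<omega> (X \<omega>)) = ?f \<omega>"
  proof (rule AE_mp, intro AE_I2 impI)
    fix \<omega> assume "\<omega> \<in> space M" "h \<omega> (X \<omega>) = normal_density (m \<omega>) s (X \<omega>)"
    then have "h \<omega> (X \<omega>) = 1 / sqrt (2 * pi * s\<^sup>2) * exp (- (L \<omega>)\<^sup>2 / (2 * s\<^sup>2))"
      by (simp add: normal_density_def X)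
    also have "ln \<dots> = - ln (sqrt (2 * pi * s\<^sup>2)) + - (L \<omega>)\<^sup>2 / (2 * s\<^sup>2)"
      using s by (subst ln_mult) (auto simp: ln_div)
    also have "ln (sqrt (2 * pi * s\<^sup>2)) = ln (2 * pi * s\<^sup>2) / 2"
      using s by (intro ln_sqrt) auto
    finally show "ln (h \<omega> (X \<omega>)) = ?f \<omega>"
      by simp
  qed
  have int_L2: "integrable M (\<lambda>\<omega>. (L \<omega>)\<^sup>2)"
    using integrable_normal_moment[OF s, of 0 2] distributed_integrable[OF L, of "\<lambda>x. x\<^sup>2"] by simp
  have E_L2: "expectation (\<lambda>\<omega>. (L \<omega>)\<^sup>2) = s\<^sup>2"
    using normal_distributed_variance[OF s L] normal_distributed_expectation[OF s L] by simp
  show "integrable M (\<lambda>\<omega>. ln (h \<omega> (X \<omega>)))"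
    using int_L2 by (subst integrable_cong_AE[OF _ _ AE]) auto
  have "expectation (\<lambda>\<omega>. ln (h \<omega> (X \<omega>))) = expectation ?f"
    by (rule integral_cong_AE[OF _ _ AE]) auto
  also have "\<dots> = - ln (2 * pi * s\<^sup>2) / 2 - s\<^sup>2 / (2 * s\<^sup>2)"
    using int_L2 E_L2 by (simp add: prob_space)
  finally show "expectation (\<lambda>\<omega>. ln (h \<omega> (X \<omega>))) = - (ln (2 * pi * s\<^sup>2) + 1) / 2"
    using s by (simp add: field_simps)
qed

section \<open>Posteriors given the market signals\<close>

fun obs_time :: "obs \<Rightarrow> nat" where
  "obs_time (Xo t) = t" | "obs_time (Yo t) = t"

text \<open>Writing the cutoffs as \<open>of_bool\<close> puts all signals over one common set of
  sources. The outcome is itself the signal \<open>Yo 0\<close>, whose noise sum is empty, so it can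
  be treated like any other signal.\<close>

fun obs_coeff :: "obs \<Rightarrow> src \<Rightarrow> real" where
  "obs_coeff ob S0 = 1"
| "obs_coeff (Xo t) (SA \<tau>) = of_bool (\<tau> \<le> t)"
| "obs_coeff (Yo t) (SA \<tau>) = 0"
| "obs_coeff ob (SB \<tau>) = of_bool (\<tau> \<le> obs_time ob)"

text \<open>Two market signals share noise of variance \<open>q + (1 - q) = 1\<close> per period;
  any other pair shares only the \<open>B\<close> noise.\<close>

fun obs_cov :: "real \<Rightarrow> real \<Rightarrow> obs \<Rightarrow> obs \<Rightarrow> real" where
  "obs_cov q \<sigma> (Xo s) (Xo t) = \<sigma>\<^sup>2 + real (min s t)"
| "obs_cov q \<sigma> ob ob' = \<sigma>\<^sup>2 + (1 - q) * real (min (obs_time ob) (obs_time ob'))"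

definition src_upto :: "nat \<Rightarrow> src set" where
  "src_upto T = {S0} \<union> SA ` {1..T} \<union> SB ` {1..T}"

fun src_sd :: "real \<Rightarrow> real \<Rightarrow> src \<Rightarrow> real" where
  "src_sd q \<sigma> S0 = \<sigma>" | "src_sd q \<sigma> (SA \<tau>) = sqrt q" | "src_sd q \<sigma> (SB \<tau>) = sqrt (1 - q)"

lemma sum_src_upto:
  "(\<Sum>i\<in>src_upto T. f i) = f S0 + (\<Sum>\<tau>=1..T. f (SA \<tau>)) + (\<Sum>\<tau>=1..T. f (SB \<tau>))"
  for f :: "src \<Rightarrow> real"
proof -
  have "(\<Sum>i\<in>src_upto T. f i) = f S0 + (\<Sum>i\<in>SA ` {1..T} \<union> SB ` {1..T}. f i)"
    unfolding src_upto_def Un_assoc by (subst sum.union_disjoint) auto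
  also have "(\<Sum>i\<in>SA ` {1..T} \<union> SB ` {1..T}. f i) = (\<Sum>i\<in>SA ` {1..T}. f i) + (\<Sum>i\<in>SB ` {1..T}. f i)"
    by (rule sum.union_disjoint) auto
  finally show ?thesis
    by (simp add: sum.reindex inj_on_def)
qed

lemma atLeastAtMost_Int_le: "{m..n} \<inter> {i. i \<le> k} = {m..min n k}" for k :: "'a :: linorder"
  by auto

lemma signal_eq_sum_sources:
  assumes "obs_time ob \<le> T"
  shows "signal X0 A B ob \<omega> = (\<Sum>i\<in>src_upto T. obs_coeff ob i * sources X0 A B i \<omega>)"
  using assms
  by (cases ob) (simp_all add: signal_def sum_src_upto sources_def atLeastAtMost_Int_le min_absorb2 sum.distrib)

lemma sum_obs_coeff_eq_obs_cov:
  assumes "0 \<le> q" "q \<le> 1" "obs_time ob \<le> T" "obs_time ob' \<le> T"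
  shows "(\<Sum>i\<in>src_upto T. obs_coeff ob i * obs_coeff ob' i * (src_sd q \<sigma> i)\<^sup>2) = obs_cov q \<sigma> ob ob'"
proof -
  have count: "(\<Sum>\<tau>=Suc 0..T. of_bool (\<tau> \<le> s) * of_bool (\<tau> \<le> t) * c) = real (min s t) * c"
    if "s \<le> T" "t \<le> T" for s t and c :: real
  proof -
    have "(\<Sum>\<tau>=Suc 0..T. of_bool (\<tau> \<le> s) * of_bool (\<tau> \<le> t) * c) =
        (\<Sum>\<tau>=Suc 0..min s t. c)"
      using that by (intro sum.mono_neutral_cong_right) auto
    also have "\<dots> = real (min s t) * c"
      by simp
    finally show ?thesis .
  qed
  have "obs_cov q \<sigma> ob ob' = \<sigma>\<^sup>2 + (case (ob, ob') of (Xo s, Xo t) \<Rightarrow> real (min s t) * q | _ \<Rightarrow> 0) +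
      real (min (obs_time ob) (obs_time ob')) * (1 - q)"
    by (cases ob; cases ob') (simp_all add: algebra_simps)
  moreover have "(\<Sum>\<tau>=Suc 0..T. obs_coeff ob (SA \<tau>) * obs_coeff ob' (SA \<tau>) * q) =
      (case (ob, ob') of (Xo s, Xo t) \<Rightarrow> real (min s t) * q | _ \<Rightarrow> 0)"
    using assms(3,4) count by (cases ob; cases ob') (simp_all only: obs_coeff.simps obs.case prod.case obs_time.simps, simp_all)
  moreover have "(\<Sum>\<tau>=Suc 0..T. obs_coeff ob (SB \<tau>) * obs_coeff ob' (SB \<tau>) * (1 - q)) =
      real (min (obs_time ob) (obs_time ob')) * (1 - q)"
    unfolding obs_coeff.simps by (rule count[OF assms(3,4)])
  ultimately show ?thesis
    using assms(1,2) by (simp only: sum_src_upto obs_coeff.simps src_sd.simps One_nat_def) simp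
qed

text \<open>The weights \<open>a\<close> regress \<open>X0\<close> on the signals in
  \<open>K\<close>, and \<open>normal_eqs\<close> are the normal equations, with
  \<open>\<sigma>\<^sup>2\<close> as the covariance of \<open>X0\<close> with every signal. They are
  demanded on all of \<open>J\<close>, which makes the residual independent of the whole information
  although its mean uses only \<open>K\<close>.\<close>

lemma (in prob_space) expected_log_posterior:
  fixes q \<sigma> :: real and a :: "obs \<Rightarrow> real"
  assumes q: "0 < q" "q < 1" and \<sigma>: "0 < \<sigma>"
    and indep: "indep_vars (\<lambda>_. borel) (sources X0 A B) src_index"
    and distX0: "distributed M lborel X0 (normal_density 0 \<sigma>)"
    and distA: "\<And>\<tau>. 1 \<le> \<tau> \<Longrightarrow> distributed M lborel (A \<tau>) (normal_density 0 (sqrt q))"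
    and distB: "\<And>\<tau>. 1 \<le> \<tau> \<Longrightarrow> distributed M lborel (B \<tau>) (normal_density 0 (sqrt (1 - q)))"
    and J: "\<And>ob. ob \<in> J \<Longrightarrow> obs_time ob \<le> T" and K: "finite K" "K \<subseteq> J"
    and normal_eqs: "\<And>ob. ob \<in> J \<Longrightarrow> (\<Sum>k\<in>K. a k * obs_cov q \<sigma> k ob) = \<sigma>\<^sup>2"
    and v: "v = \<sigma>\<^sup>2 * (1 - sum a K)" "0 < v"
    and h: "cond_density M (gen_sigma M (signal X0 A B) J) X0 h"
  shows "integrable M (\<lambda>\<omega>. ln (h \<omega> (X0 \<omega>)))"
    and "expectation (\<lambda>\<omega>. ln (h \<omega> (X0 \<omega>))) = - (ln (2 * pi * v) + 1) / 2"
proof -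
  let ?I = "src_upto T" and ?Z = "sources X0 A B" and ?s = "src_sd q \<sigma>"
  let ?Y = "signal X0 A B"
  \<comment> \<open>Coefficients of the residual of \<open>X0\<close>, which enters as
    \<open>Yo 0\<close>.\<close>
  define c where "c = (\<lambda>i. obs_coeff (Yo 0) i - (\<Sum>k\<in>K. a k * obs_coeff k i))"
  let ?L = "\<lambda>\<omega>. \<Sum>i\<in>?I. c i * ?Z i \<omega>" and ?m = "\<lambda>\<omega>. \<Sum>k\<in>K. a k * ?Y k \<omega>"
  have I: "finite ?I" "S0 \<in> ?I"
    by (auto simp: src_upto_def)
  have cS0: "c S0 = 1 - sum a K"
    by (simp add: c_def)
  with v have c_nz: "c S0 \<noteq> 0"
    by auto
  have indep': "indep_vars (\<lambda>_. borel) ?Z ?I"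
    by (rule indep_vars_subset[OF indep]) (auto simp: src_upto_def src_index_def)
  have s: "0 < ?s i" for i
    using q \<sigma> by (cases i) auto
  have Z: "distributed M lborel (?Z i) (normal_density 0 (?s i))" if "i \<in> ?I" for i
    using that distX0 distA distB by (auto simp: src_upto_def sources_def)
  have Zm [measurable]: "?Z i \<in> borel_measurable M" if "i \<in> ?I" for i
    using Z[OF that] by (simp add: distributed_def)
  have Y: "?Y ob \<omega> = (\<Sum>i\<in>?I. obs_coeff ob i * ?Z i \<omega>)" if "ob \<in> J" for ob \<omega>
    by (rule signal_eq_sum_sources[OF J[OF that]])
  have Ym: "?Y ob \<in> borel_measurable M" if "ob \<in> J" for ob
    unfolding Y[OF that] by measurable
  have cov: "(\<Sum>i\<in>?I. c i * obs_coeff ob i * (?s i)\<^sup>2) =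
      obs_cov q \<sigma> (Yo 0) ob - (\<Sum>k\<in>K. a k * obs_cov q \<sigma> k ob)" if "obs_time ob \<le> T" for ob
  proof -
    have "(\<Sum>i\<in>?I. c i * obs_coeff ob i * (?s i)\<^sup>2) =
        (\<Sum>i\<in>?I. obs_coeff (Yo 0) i * obs_coeff ob i * (?s i)\<^sup>2) -
        (\<Sum>i\<in>?I. \<Sum>k\<in>K. a k * (obs_coeff k i * obs_coeff ob i * (?s i)\<^sup>2))"
      unfolding c_def sum_subtractf[symmetric]
      by (intro sum.cong refl) (simp add: left_diff_distrib sum_distrib_right mult.assoc)
    also have "(\<Sum>i\<in>?I. \<Sum>k\<in>K. a k * (obs_coeff k i * obs_coeff ob i * (?s i)\<^sup>2)) =
        (\<Sum>k\<in>K. a k * (\<Sum>i\<in>?I. obs_coeff k i * obs_coeff ob i * (?s i)\<^sup>2))"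
      by (subst sum.swap) (simp add: sum_distrib_left)
    also have "\<dots> = (\<Sum>k\<in>K. a k * obs_cov q \<sigma> k ob)"
      using q that K(2) J by (intro sum.cong refl arg_cong2[where f = times] sum_obs_coeff_eq_obs_cov) auto
    also have "(\<Sum>i\<in>?I. obs_coeff (Yo 0) i * obs_coeff ob i * (?s i)\<^sup>2) = obs_cov q \<sigma> (Yo 0) ob"
      using q that by (intro sum_obs_coeff_eq_obs_cov) auto
    finally show ?thesis .
  qed
  have cov0: "obs_cov q \<sigma> (Yo 0) ob = \<sigma>\<^sup>2" "obs_cov q \<sigma> ob (Yo 0) = \<sigma>\<^sup>2" for ob
    by (cases ob; simp)+
  have uncorrelated: "(\<Sum>i\<in>?I. c i * obs_coeff ob i * (?s i)\<^sup>2) = 0" if "ob \<in> J" for ob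
    using cov[OF J[OF that]] normal_eqs[OF that] cov0 by simp
  \<comment> \<open>The residual is uncorrelated with every signal used in the regression, so its
    variance is just its covariance with \<open>X0\<close>.\<close>
  have var: "(\<Sum>i\<in>?I. (c i)\<^sup>2 * (?s i)\<^sup>2) = v"
  proof -
    have "(\<Sum>i\<in>?I. (c i)\<^sup>2 * (?s i)\<^sup>2) =
        (\<Sum>i\<in>?I. c i * obs_coeff (Yo 0) i * (?s i)\<^sup>2) - (\<Sum>i\<in>?I. \<Sum>k\<in>K. a k * (c i * obs_coeff k i * (?s i)\<^sup>2))"
      unfolding sum_subtractf[symmetric]
    proof (intro sum.cong refl)
      fix i
      have "(c i)\<^sup>2 * (?s i)\<^sup>2 = c i * (?s i)\<^sup>2 * (obs_coeff (Yo 0) i - (\<Sum>k\<in>K. a k * obs_coeff k i))"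
        by (simp add: power2_eq_square c_def)
      also have "\<dots> = c i * obs_coeff (Yo 0) i * (?s i)\<^sup>2 - (\<Sum>k\<in>K. a k * (c i * obs_coeff k i * (?s i)\<^sup>2))"
        by (simp add: right_diff_distrib sum_distrib_left ac_simps)
      finally show "(c i)\<^sup>2 * (?s i)\<^sup>2 =
          c i * obs_coeff (Yo 0) i * (?s i)\<^sup>2 - (\<Sum>k\<in>K. a k * (c i * obs_coeff k i * (?s i)\<^sup>2))" .
    qed
    also have "(\<Sum>i\<in>?I. \<Sum>k\<in>K. a k * (c i * obs_coeff k i * (?s i)\<^sup>2)) =
        (\<Sum>k\<in>K. a k * (\<Sum>i\<in>?I. c i * obs_coeff k i * (?s i)\<^sup>2))"
      by (subst sum.swap) (simp add: sum_distrib_left)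
    also have "\<dots> = 0"
      using K(2) by (intro sum.neutral) (auto simp: uncorrelated)
    also have "(\<Sum>i\<in>?I. c i * obs_coeff (Yo 0) i * (?s i)\<^sup>2) = \<sigma>\<^sup>2 - (\<Sum>k\<in>K. a k * \<sigma>\<^sup>2)"
      by (subst cov) (simp_all only: cov0 obs_time.simps)
    finally show ?thesis
      by (simp add: v algebra_simps flip: sum_distrib_right)
  qed
  have X0: "X0 \<omega> = ?m \<omega> + ?L \<omega>" for \<omega>
  proof -
    have "?L \<omega> = (\<Sum>i\<in>?I. obs_coeff (Yo 0) i * ?Z i \<omega>) - (\<Sum>i\<in>?I. \<Sum>k\<in>K. a k * (obs_coeff k i * ?Z i \<omega>))"
      unfolding c_def sum_subtractf[symmetric]
      by (intro sum.cong refl) (simp add: left_diff_distrib sum_distrib_right mult.assoc)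
    also have "(\<Sum>i\<in>?I. \<Sum>k\<in>K. a k * (obs_coeff k i * ?Z i \<omega>)) = (\<Sum>k\<in>K. a k * (\<Sum>i\<in>?I. obs_coeff k i * ?Z i \<omega>))"
      by (subst sum.swap) (simp add: sum_distrib_left)
    also have "\<dots> = ?m \<omega>"
      using K(2) by (intro sum.cong refl) (auto simp: Y)
    also have "(\<Sum>i\<in>?I. obs_coeff (Yo 0) i * ?Z i \<omega>) = X0 \<omega>"
      by (subst signal_eq_sum_sources[symmetric]) (simp_all add: signal_def)
    finally show ?thesis
      by simp
  qed
  have L: "distributed M lborel ?L (normal_density 0 (sqrt v))"
    using distributed_linear_combination_normal[of ?I S0 c ?Z ?s] I c_nz indep' s Z var by simp
  have indepL: "indep_rv M (gen_sigma M ?Y J) (\<lambda>\<omega>. \<omega>) borel ?L"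
    by (rule indep_rv_uncorrelated_normal[OF I c_nz indep' s Z Y uncorrelated])
  have m: "?m \<in> borel_measurable (gen_sigma M ?Y J)"
    using K(2) by (intro borel_measurable_sum borel_measurable_times borel_measurable_const measurable_gen_sigma) auto
  have sv: "0 < sqrt v" "(sqrt v)\<^sup>2 = v"
    using v(2) by auto
  note * = expected_log_cond_density_normal[OF subalgebra_gen_sigma[OF Ym] indepL sv(1) L m X0 h, unfolded sv(2)]
  show "integrable M (\<lambda>\<omega>. ln (h \<omega> (X0 \<omega>)))"
    by (rule *(1))
  show "expectation (\<lambda>\<omega>. ln (h \<omega> (X0 \<omega>))) = - (ln (2 * pi * v) + 1) / 2"
    by (rule *(2))
qed

text \<open>The posterior variance of \<open>X0\<close> before the prediction at time \<open>t\<close>, under a flat prior.\<close>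
definition var_before :: "real \<Rightarrow> nat \<Rightarrow> nat \<Rightarrow> real" where
  "var_before q T t =
     (if t < T then (1 - q) * real t * (real t + 1) / (real t + 1 - q) else real t)"

lemma var_before_pos: "0 < q \<Longrightarrow> q < 1 \<Longrightarrow> 1 \<le> t \<Longrightarrow> 0 < var_before q T t"
  by (auto simp: var_before_def intro!: divide_pos_pos mult_pos_pos)

text \<open>Here \<open>p\<close> is the prior variance and \<open>w\<close> the posterior variance
  under a flat prior. Precisions add, which gives \<open>p * w / (p + w)\<close>, and
  \<open>p / (p + w)\<close> is the factor by which the flat-prior weights shrink.\<close>

lemma prior_posterior_variance:
  fixes p w :: real
  assumes "0 < p" "0 < w"
  shows "p * (1 - p / (p + w)) = p * w / (p + w)" "0 < p * w / (p + w)" "p / (p + w) * (p + w) = p"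
proof -
  have "0 < p + w"
    using assms by simp
  then show "p * (1 - p / (p + w)) = p * w / (p + w)" "0 < p * w / (p + w)" "p / (p + w) * (p + w) = p"
    using assms by (simp_all add: field_simps)
qed

section \<open>Posterior variances around one prediction\<close>

context prob_space
begin

context
  fixes q \<sigma> :: real and X0 :: "'a \<Rightarrow> real" and A B :: "nat \<Rightarrow> 'a \<Rightarrow> real" and T t :: nat
  assumes q: "0 < q" "q < 1" and \<sigma>: "0 < \<sigma>"
    and indep: "indep_vars (\<lambda>_. borel) (sources X0 A B) src_index"
    and distX0: "distributed M lborel X0 (normal_density 0 \<sigma>)"
    and distA: "\<And>\<tau>. 1 \<le> \<tau> \<Longrightarrow> distributed M lborel (A \<tau>) (normal_density 0 (sqrt q))"
    and distB: "\<And>\<tau>. 1 \<le> \<tau> \<Longrightarrow> distributed M lborel (B \<tau>) (normal_density 0 (sqrt (1 - q)))"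
    and t: "1 \<le> t" "t \<le> T"
begin

text \<open>\<open>Yo t\<close> alone is sufficient: every signal in the information has time at
  least \<open>t\<close>, so its covariance with \<open>Yo t\<close> is
  \<open>\<sigma>\<^sup>2 + w\<close>, and the single weight \<open>k\<close> solves all the normal
  equations.\<close>

lemma expected_log_density_after:
  assumes h: "cond_density M (gen_sigma M (signal X0 A B) (info_after T t)) X0 h"
  defines "w \<equiv> (1 - q) * real t"
  shows "integrable M (\<lambda>\<omega>. ln (h \<omega> (X0 \<omega>)))"
    and "expectation (\<lambda>\<omega>. ln (h \<omega> (X0 \<omega>))) = - (ln (2 * pi * (\<sigma>\<^sup>2 * w / (\<sigma>\<^sup>2 + w))) + 1) / 2"
proof -
  have w: "0 < w"
    using q t by (simp add: w_def)
  define k where "k = \<sigma>\<^sup>2 / (\<sigma>\<^sup>2 + w)"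
  have J: "obs_time ob \<le> T" if "ob \<in> info_after T t" for ob
    using that by (auto simp: info_after_def)
  have K: "finite {Yo t}" "{Yo t} \<subseteq> info_after T t"
    using t by (auto simp: info_after_def)
  have eqs: "(\<Sum>ob'\<in>{Yo t}. k * obs_cov q \<sigma> ob' ob) = \<sigma>\<^sup>2" if "ob \<in> info_after T t" for ob
    using that prior_posterior_variance(3)[OF zero_less_power[OF \<sigma>] w] by (auto simp: info_after_def k_def w_def min_absorb1)
  have v: "\<sigma>\<^sup>2 * w / (\<sigma>\<^sup>2 + w) = \<sigma>\<^sup>2 * (1 - (\<Sum>ob'\<in>{Yo t}. k))"
    using prior_posterior_variance(1)[OF zero_less_power[OF \<sigma>] w] by (simp add: k_def)
  note * = expected_log_posterior[OF q \<sigma> indep distX0 distA distB J K eqs v prior_posterior_variance(2)[OF zero_less_power[OF \<sigma>] w] h]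
  show "integrable M (\<lambda>\<omega>. ln (h \<omega> (X0 \<omega>)))"
    by (rule *(1))
  show "expectation (\<lambda>\<omega>. ln (h \<omega> (X0 \<omega>))) = - (ln (2 * pi * (\<sigma>\<^sup>2 * w / (\<sigma>\<^sup>2 + w))) + 1) / 2"
    by (rule *(2))
qed

text \<open>There are two regimes because the first prediction finds no announcement: for
  \<open>t = T\<close> the information is \<open>Xo T\<close> alone, while for \<open>t < T\<close>
  the two market signals at \<open>t\<close> and \<open>t + 1\<close> and the latest announcement
  suffice.\<close>

lemma expected_log_density_before:
  assumes h: "cond_density M (gen_sigma M (signal X0 A B) (info_before T t)) X0 h"
  defines "w \<equiv> var_before q T t"
  shows "integrable M (\<lambda>\<omega>. ln (h \<omega> (X0 \<omega>)))"
    and "expectation (\<lambda>\<omega>. ln (h \<omega> (X0 \<omega>))) = - (ln (2 * pi * (\<sigma>\<^sup>2 * w / (\<sigma>\<^sup>2 + w))) + 1) / 2"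
proof -
  have w: "0 < w"
    unfolding w_def using q t by (intro var_before_pos)
  define k where "k = \<sigma>\<^sup>2 / (\<sigma>\<^sup>2 + w)"
  have k: "k * (\<sigma>\<^sup>2 + w) = \<sigma>\<^sup>2"
    unfolding k_def by (rule prior_posterior_variance(3)[OF zero_less_power[OF \<sigma>] w])
  have J: "obs_time ob \<le> T" if "ob \<in> info_before T t" for ob
    using that by (auto simp: info_before_def)
  have "\<exists>K a. finite K \<and> K \<subseteq> info_before T t \<and> sum a K = k \<and>
      (\<forall>ob\<in>info_before T t. (\<Sum>ob'\<in>K. a ob' * obs_cov q \<sigma> ob' ob) = \<sigma>\<^sup>2)"
  proof (cases "t < T")
    case False
    with t have "t = T"
      by simp
    then show ?thesis
      using k by (intro exI[of _ "{Xo t}"] exI[of _ "\<lambda>_. k"])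
        (auto simp: info_before_def w_def var_before_def)
  next
    case True
    \<comment> \<open>\<open>Y\<^bsub>t+1\<^esub> - (1 - q) (X\<^bsub>t+1\<^esub> - X\<^sub>t)\<close> estimates \<open>Y\<^sub>t\<close> with an error independent of
      \<open>X\<^bsub>t+1\<^esub> - X\<^sub>t\<close>; it is combined with \<open>X\<^sub>t\<close> by weighting with the precisions
      \<open>1 / (q (1 - q))\<close> and \<open>1 / (q t)\<close>.\<close>
    define n where "n = real t + 1 - q"
    define a where "a = (\<lambda>ob. case ob of
      Xo s \<Rightarrow> if s = t then k * (1 - q) * (real t + 1) / n else - (k * (1 - q) * real t / n)
      | Yo s \<Rightarrow> k * real t / n)"
    have n: "0 < n"
      using q t by (simp add: n_def)
    let ?K = "{Xo t, Xo (t + 1), Yo (t + 1)}"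
    have sumK: "(\<Sum>ob\<in>?K. a ob * f ob) = k * (1 - q) * (real t + 1) / n * f (Xo t)
        - k * (1 - q) * real t / n * f (Xo (t + 1)) + k * real t / n * f (Yo (t + 1))" for f
      by (simp add: a_def)
    \<comment> \<open>This is the variance \<open>(1 - q) * real t\<close> of the private signal at
      time \<open>t\<close> around \<open>X0\<close>, plus the error variance
      \<open>q * (1 - q) * real t / n\<close> of its combined estimate, obtained by adding the two
      precisions.\<close>
    have w_eq: "w = (1 - q) * real t * (real t + 1) / n"
      using True by (simp add: w_def var_before_def n_def)
    \<comment> \<open>Without the factor \<open>k\<close> the weights sum to one, as they must for
      an estimate that is unbiased for every value of the outcome; \<open>k\<close> is the shrinkage
      towards the prior mean.\<close>
    have "sum a ?K = (\<Sum>ob\<in>?K. a ob * 1)"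
      by simp
    also have "\<dots> = k * ((1 - q) * (real t + 1) - (1 - q) * real t + real t) / n"
      unfolding sumK using n by (simp add: field_simps)
    also have "\<dots> = k"
      using n by (simp add: n_def field_simps)
    finally have sum_a: "sum a ?K = k" .
    have eqs: "(\<Sum>ob'\<in>?K. a ob' * obs_cov q \<sigma> ob' ob) = \<sigma>\<^sup>2" if "ob \<in> info_before T t" for ob
    proof -
      consider s where "ob = Xo s" "t \<le> s" | s where "ob = Yo s" "t < s"
        using \<open>ob \<in> info_before T t\<close> by (auto simp: info_before_def)
      then have "(\<Sum>ob'\<in>?K. a ob' * obs_cov q \<sigma> ob' ob) = \<sigma>\<^sup>2 * sum a ?K + k * w"
      proof cases
        case (1 s)
        have "(\<Sum>ob'\<in>?K. a ob' * obs_cov q \<sigma> ob' ob) = (\<Sum>ob'\<in>?K. a ob' * \<sigma>\<^sup>2)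
           + (\<Sum>ob'\<in>?K. a ob' * (obs_cov q \<sigma> ob' ob - \<sigma>\<^sup>2))"
          unfolding sum.distrib[symmetric] by (simp add: algebra_simps)
        \<comment> \<open>The terms of \<open>Xo (t + 1)\<close> and \<open>Yo (t + 1)\<close>
          cancel whatever \<open>min (t + 1) s\<close> is, so \<open>s = t\<close> and
          \<open>s > t\<close> are treated alike.\<close>
        also have "(\<Sum>ob'\<in>?K. a ob' * (obs_cov q \<sigma> ob' ob - \<sigma>\<^sup>2)) = k * w"
          unfolding sumK w_eq using 1 by (simp add: min_absorb1)
        finally show ?thesis
          by (simp only: sum_distrib_right[symmetric] mult.commute)
      next
        case (2 s)
        then have [simp]: "min t s = t" "min (Suc t) s = Suc t"
          by auto
        have "(\<Sum>ob'\<in>?K. a ob' * obs_cov q \<sigma> ob' ob) = (\<Sum>ob'\<in>?K. a ob' * \<sigma>\<^sup>2)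
           + (\<Sum>ob'\<in>?K. a ob' * (obs_cov q \<sigma> ob' ob - \<sigma>\<^sup>2))"
          unfolding sum.distrib[symmetric] by (simp add: algebra_simps)
        \<comment> \<open>Now the terms of the two market signals cancel instead, and only that of
          \<open>Yo (t + 1)\<close> remains.\<close>
        also have "(\<Sum>ob'\<in>?K. a ob' * (obs_cov q \<sigma> ob' ob - \<sigma>\<^sup>2)) =
            k * (1 - q) * real t * (real t + 1) / n * ((1 - q) - (1 - q) + 1)"
          unfolding sumK using 2 n by (simp add: field_simps)
        also have "\<dots> = k * w"
          unfolding w_eq by simp
        finally show ?thesis
          by (simp only: sum_distrib_right[symmetric] mult.commute)
      qed
      then show ?thesis
        using k unfolding sum_a by (simp add: algebra_simps)
    qed
    show ?thesis
      using True sum_a eqs by (intro exI[of _ ?K] exI[of _ a]) (auto simp: info_before_def)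
  qed
  then obtain K a where K: "finite K" "K \<subseteq> info_before T t" and a: "sum a K = k"
    and eqs: "\<And>ob. ob \<in> info_before T t \<Longrightarrow> (\<Sum>ob'\<in>K. a ob' * obs_cov q \<sigma> ob' ob) = \<sigma>\<^sup>2"
    by blast
  have v: "\<sigma>\<^sup>2 * w / (\<sigma>\<^sup>2 + w) = \<sigma>\<^sup>2 * (1 - sum a K)"
    using prior_posterior_variance(1)[OF zero_less_power[OF \<sigma>] w] by (simp add: a k_def)
  note * = expected_log_posterior[OF q \<sigma> indep distX0 distA distB J K eqs v prior_posterior_variance(2)[OF zero_less_power[OF \<sigma>] w] h]
  show "integrable M (\<lambda>\<omega>. ln (h \<omega> (X0 \<omega>)))"
    by (rule *(1))
  show "expectation (\<lambda>\<omega>. ln (h \<omega> (X0 \<omega>))) = - (ln (2 * pi * (\<sigma>\<^sup>2 * w / (\<sigma>\<^sup>2 + w))) + 1) / 2"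
    by (rule *(2))
qed

end

end

section \<open>The limit of a flat prior and the growth in the horizon\<close>

lemma tendsto_ln_posterior_variance:
  fixes w :: real
  assumes w: "0 < w"
  shows "((\<lambda>\<sigma>. ln (\<sigma>\<^sup>2 * w / (\<sigma>\<^sup>2 + w))) \<longlongrightarrow> ln w) at_top"
proof -
  have "filterlim (\<lambda>\<sigma>::real. \<sigma>\<^sup>2) at_infinity at_top"
    by (intro filterlim_at_top_imp_at_infinity filterlim_pow_at_top filterlim_ident) auto
  then have "((\<lambda>\<sigma>::real. w / \<sigma>\<^sup>2) \<longlongrightarrow> 0) at_top"
    by (rule tendsto_divide_0[OF tendsto_const])
  then have "((\<lambda>\<sigma>::real. w / (1 + w / \<sigma>\<^sup>2)) \<longlongrightarrow> w / (1 + 0)) at_top"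
    by (intro tendsto_divide tendsto_add tendsto_const) auto
  moreover have "eventually (\<lambda>\<sigma>::real. w / (1 + w / \<sigma>\<^sup>2) = \<sigma>\<^sup>2 * w / (\<sigma>\<^sup>2 + w)) at_top"
    using eventually_gt_at_top[of 0]
  proof eventually_elim
    case (elim \<sigma>)
    then have "0 < \<sigma>\<^sup>2"
      by simp
    then show ?case
      using w by (simp add: field_simps add_pos_pos less_imp_neq[symmetric])
  qed
  ultimately have "((\<lambda>\<sigma>. \<sigma>\<^sup>2 * w / (\<sigma>\<^sup>2 + w)) \<longlongrightarrow> w) at_top"
    using tendsto_cong by force
  then show ?thesis
    using w by (intro tendsto_ln) auto
qed

text \<open>The summands agree only after a cyclic shift: the prediction at time
  \<open>t < T\<close> accounts for the summand with index \<open>t + 1\<close>, and the first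
  prediction, at time \<open>T\<close>, for the one with index 1.\<close>

lemma sum_ln_var_ratio:
  assumes q: "0 < q" "q < 1" and T: "1 \<le> T"
  shows "(\<Sum>t=1..T. ln (var_before q T t) - ln ((1 - q) * real t)) = (\<Sum>t=1..T. ln (real t / (real t - q)))"
proof -
  obtain n where n: "T = Suc n"
    using T by (cases T) auto
  let ?f = "\<lambda>t. ln (real t / (real t - q))"
  have "(\<Sum>t=1..T. ln (var_before q T t) - ln ((1 - q) * real t)) =
     (\<Sum>t=1..n. ?f (Suc t)) + ?f 1"
  proof -
    have "ln (var_before q T t) - ln ((1 - q) * real t) = ?f (Suc t)" if "t \<in> {1..n}" for t
    proof -
      have "0 < (1 - q) * real t"
        using that q by auto
      then have "ln (var_before q T t) - ln ((1 - q) * real t) = ln (var_before q T t / ((1 - q) * real t))"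
        using var_before_pos[OF q, of t T] that by (subst ln_div) auto
      also have "var_before q T t / ((1 - q) * real t) = real (Suc t) / (real (Suc t) - q)"
        using that q by (simp add: var_before_def n add.commute)
      finally show ?thesis .
    qed
    moreover have "ln (var_before q T T) - ln ((1 - q) * real T) = ?f 1"
      using q T by (simp add: var_before_def ln_mult ln_div)
    ultimately show ?thesis
      by (simp add: n)
  qed
  also have "\<dots> = (\<Sum>t=1..T. ?f t)"
    by (simp add: n sum.atLeast_Suc_atMost sum.shift_bounds_cl_Suc_ivl del: sum.cl_ivl_Suc)
  finally show ?thesis .
qed

section \<open>Closed form and asymptotics through the Gamma function\<close>

lemma sum_ln_ratio_eq_ln_Gamma:
  fixes q :: real
  assumes q: "q < 1"
  shows "(\<Sum>t=1..T. ln (real t / (real t - q))) =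
    ln (Gamma (1 - q) * Gamma (real T + 1) / Gamma (real T + 1 - q))"
proof (induction T)
  case 0
  have "Gamma (1 - q) > 0"
    using q by simp
  then show ?case
    by simp
next
  case (Suc T)
  have pos: "0 < Gamma (1 - q)" "0 < Gamma (real T + 1)" "0 < Gamma (real T + 1 - q)" "0 < real T + 1 - q"
    using q by (auto intro!: Gamma_real_pos)
  have "real T + 1 \<notin> \<int>\<^sub>\<le>\<^sub>0" "real T + 1 - q \<notin> \<int>\<^sub>\<le>\<^sub>0"
    using pos q by (auto elim!: nonpos_Ints_cases)
  then have "Gamma (real (Suc T) + 1) = (real T + 1) * Gamma (real T + 1)"
    "Gamma (real (Suc T) + 1 - q) = (real T + 1 - q) * Gamma (real T + 1 - q)"
    using Gamma_plus1[of "real T + 1"] Gamma_plus1[of "real T + 1 - q"] by (simp_all add: algebra_simps)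
  then have "Gamma (1 - q) * Gamma (real (Suc T) + 1) / Gamma (real (Suc T) + 1 - q) =
     (real (Suc T) / (real (Suc T) - q)) * (Gamma (1 - q) * Gamma (real T + 1) / Gamma (real T + 1 - q))"
    by (simp add: add.commute)
  also have "ln \<dots> = ln (real (Suc T) / (real (Suc T) - q)) +
      ln (Gamma (1 - q) * Gamma (real T + 1) / Gamma (real T + 1 - q))"
    using pos by (intro ln_mult_pos divide_pos_pos mult_pos_pos) auto
  finally show ?case
    using Suc.IH by simp
qed

text \<open>The product of the ratios is \<open>fact T / pochhammer (1 - q) T\<close>, which is
  Gauss's product for \<open>Gamma (1 - q)\<close> up to the factor
  \<open>exp (- q * ln (real T))\<close>.\<close>

lemma sum_ln_ratio_asymp:
  fixes q :: real
  assumes q: "q < 1"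
  shows "(\<lambda>T. (\<Sum>t=1..T. ln (real t / (real t - q))) - q * ln (real T)) \<longlonglongrightarrow> ln (Gamma (1 - q))"
proof -
  have prod: "(\<Sum>t=1..T. ln (real t / (real t - q))) = ln (fact T / pochhammer (1 - q) T)" for T
  proof (induction T)
    case (Suc T)
    have pos: "0 < pochhammer (1 - q) T" "0 < real T + 1 - q"
      using q by (auto intro!: pochhammer_pos)
    have "fact (Suc T) / pochhammer (1 - q) (Suc T) =
        real (Suc T) / (real (Suc T) - q) * (fact T / pochhammer (1 - q) T)"
      by (simp add: pochhammer_Suc algebra_simps)
    also have "ln \<dots> = ln (real (Suc T) / (real (Suc T) - q)) + ln (fact T / pochhammer (1 - q) T)"
      using pos by (intro ln_mult_pos) auto
    finally show ?case
      using Suc.IH by simp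
  qed simp
  have "eventually (\<lambda>T. ln (Gamma_series' (1 - q) T) =
      (\<Sum>t=1..T. ln (real t / (real t - q))) - q * ln (real T)) sequentially"
    using eventually_gt_at_top[of 0]
  proof eventually_elim
    case (elim T)
    have pos: "0 < pochhammer (1 - q) T"
      using q by (auto intro!: pochhammer_pos)
    \<comment> \<open>\<open>Gamma_series'\<close> carries \<open>fact (T - 1)\<close> and the
      exponent \<open>1 - q\<close>; absorbing one factor \<open>T\<close> into the factorial,
      possible as \<open>T > 0\<close>, leaves the exponent \<open>- q\<close>.\<close>
    have "Gamma_series' (1 - q) T = (fact T / pochhammer (1 - q) T) * exp (- q * ln (real T))"
      using elim by (simp add: Gamma_series'_def fact_reduce[of T] algebra_simps exp_diff exp_minus field_simps)
    also have "ln \<dots> = ln (fact T / pochhammer (1 - q) T) - q * ln (real T)"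
      using pos by (subst ln_mult_pos) auto
    finally show ?case
      by (simp only: prod)
  qed
  moreover have "(\<lambda>T. ln (Gamma_series' (1 - q) T)) \<longlonglongrightarrow> ln (Gamma (1 - q))"
    using q by (intro tendsto_ln Gamma_series'_LIMSEQ) (auto simp: less_imp_neq[symmetric])
  ultimately show ?thesis
    by (rule Lim_transform_eventually[rotated])
qed

theorem theorem2:
  fixes q :: real
    and M :: "real \<Rightarrow> 'a measure"
    and X0 :: "real \<Rightarrow> 'a \<Rightarrow> real"
    and A B :: "real \<Rightarrow> nat \<Rightarrow> 'a \<Rightarrow> real"
    and hm hp :: "real \<Rightarrow> nat \<Rightarrow> nat \<Rightarrow> 'a \<Rightarrow> real \<Rightarrow> real"
  assumes q: "0 < q" "q < 1"
    and prob: "\<And>\<sigma>. 0 < \<sigma> \<Longrightarrow> prob_space (M \<sigma>)"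
    and indep: "\<And>\<sigma>. 0 < \<sigma> \<Longrightarrow>
         prob_space.indep_vars (M \<sigma>) (\<lambda>_. borel) (sources (X0 \<sigma>) (A \<sigma>) (B \<sigma>)) src_index"
    and distX0: "\<And>\<sigma>. 0 < \<sigma> \<Longrightarrow> distributed (M \<sigma>) lborel (X0 \<sigma>) (normal_density 0 \<sigma>)"
    and distA: "\<And>\<sigma> \<tau>. 0 < \<sigma> \<Longrightarrow> 1 \<le> \<tau> \<Longrightarrow>
         distributed (M \<sigma>) lborel (A \<sigma> \<tau>) (normal_density 0 (sqrt q))"
    and distB: "\<And>\<sigma> \<tau>. 0 < \<sigma> \<Longrightarrow> 1 \<le> \<tau> \<Longrightarrow>
         distributed (M \<sigma>) lborel (B \<sigma> \<tau>) (normal_density 0 (sqrt (1 - q)))"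
    and dens_before: "\<And>\<sigma> T t. 0 < \<sigma> \<Longrightarrow> 1 \<le> t \<Longrightarrow> t \<le> T \<Longrightarrow>
         cond_density (M \<sigma>)
           (gen_sigma (M \<sigma>) (signal (X0 \<sigma>) (A \<sigma>) (B \<sigma>)) (info_before T t))
           (X0 \<sigma>) (hm \<sigma> T t)"
    and dens_after: "\<And>\<sigma> T t. 0 < \<sigma> \<Longrightarrow> 1 \<le> t \<Longrightarrow> t \<le> T \<Longrightarrow>
         cond_density (M \<sigma>)
           (gen_sigma (M \<sigma>) (signal (X0 \<sigma>) (A \<sigma>) (B \<sigma>)) (info_after T t))
           (X0 \<sigma>) (hp \<sigma> T t)"
  shows "\<exists>\<Xi> :: nat \<Rightarrow> real.
           (\<forall>T\<ge>1. ((\<lambda>\<sigma>. expected_reward (M \<sigma>) (X0 \<sigma>) (hm \<sigma> T) (hp \<sigma> T) T) \<longlongrightarrow> \<Xi> T) at_top)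
         \<and> (\<forall>T\<ge>1. \<Xi> T = 1/2 * (\<Sum>t\<in>{1..T}. ln (real t / (real t - q))))
         \<and> (\<forall>T\<ge>1. \<Xi> T = 1/2 * ln (Gamma (1 - q) * Gamma (real T + 1) / Gamma (real T + 1 - q)))
         \<and> \<Xi> \<in> O(\<lambda>T. ln (real T))
         \<and> ((\<lambda>T. \<Xi> T / (q * ln (real T) + ln (Gamma (1 - q)))) \<longlonglongrightarrow> 1/2)"
proof -
  define \<Xi> where "\<Xi> = (\<lambda>T. 1/2 * (\<Sum>t\<in>{1..T}. ln (real t / (real t - q))))"
  have limit: "((\<lambda>\<sigma>. expected_reward (M \<sigma>) (X0 \<sigma>) (hm \<sigma> T) (hp \<sigma> T) T) \<longlongrightarrow> \<Xi> T) at_top"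
    if T: "1 \<le> T" for T
  proof -
    \<comment> \<open>\<open>?wm\<close> and \<open>?wp\<close> are the flat-prior variances before
      and after a prediction; \<open>?v\<close> adds the prior precision to them.\<close>
    let ?v = "\<lambda>\<sigma> w. \<sigma>\<^sup>2 * w / (\<sigma>\<^sup>2 + w)" and ?wm = "var_before q T" and ?wp = "\<lambda>t. (1 - q) * real t"
    have w_pos: "0 < ?wm t" "0 < ?wp t" if "t \<in> {1..T}" for t
      using that q var_before_pos[OF q, of t T] by auto
    have reward: "expected_reward (M \<sigma>) (X0 \<sigma>) (hm \<sigma> T) (hp \<sigma> T) T =
        (\<Sum>t\<in>{1..T}. (ln (?v \<sigma> (?wm t)) - ln (?v \<sigma> (?wp t))) / 2)" if \<sigma>: "0 < \<sigma>" for \<sigma>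
    proof -
      interpret prob_space "M \<sigma>"
        by (rule prob[OF \<sigma>])
      note after = expected_log_density_after[OF q \<sigma> indep[OF \<sigma>] distX0[OF \<sigma>] distA[OF \<sigma>] distB[OF \<sigma>] _ _ dens_after[OF \<sigma>]]
      note before = expected_log_density_before[OF q \<sigma> indep[OF \<sigma>] distX0[OF \<sigma>] distA[OF \<sigma>] distB[OF \<sigma>] _ _ dens_before[OF \<sigma>]]
      have "expected_reward (M \<sigma>) (X0 \<sigma>) (hm \<sigma> T) (hp \<sigma> T) T =
          (\<Sum>t\<in>{1..T}. expectation (\<lambda>\<omega>. ln (hp \<sigma> T t \<omega> (X0 \<sigma> \<omega>))) - expectation (\<lambda>\<omega>. ln (hm \<sigma> T t \<omega> (X0 \<sigma> \<omega>))))"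
        unfolding expected_reward_def using after(1) before(1)
        by (subst Bochner_Integration.integral_sum) auto
      also have "\<dots> = (\<Sum>t\<in>{1..T}. (ln (?v \<sigma> (?wm t)) - ln (?v \<sigma> (?wp t))) / 2)"
      proof (rule sum.cong[OF refl])
        fix t assume t: "t \<in> {1..T}"
        have ln: "ln (2 * pi * ?v \<sigma> w) = ln (2 * pi) + ln (?v \<sigma> w)" if "0 < w" for w
          using prior_posterior_variance(2)[OF zero_less_power[OF \<sigma>] that] by (intro ln_mult_pos) auto
        have after_t: "expectation (\<lambda>\<omega>. ln (hp \<sigma> T t \<omega> (X0 \<sigma> \<omega>))) = - (ln (2 * pi * ?v \<sigma> (?wp t)) + 1) / 2"
          by (rule after(2)) (use t in auto)
        have before_t: "expectation (\<lambda>\<omega>. ln (hm \<sigma> T t \<omega> (X0 \<sigma> \<omega>))) = - (ln (2 * pi * ?v \<sigma> (?wm t)) + 1) / 2"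
          by (rule before(2)) (use t in auto)
        show "expectation (\<lambda>\<omega>. ln (hp \<sigma> T t \<omega> (X0 \<sigma> \<omega>))) - expectation (\<lambda>\<omega>. ln (hm \<sigma> T t \<omega> (X0 \<sigma> \<omega>))) =
            (ln (?v \<sigma> (?wm t)) - ln (?v \<sigma> (?wp t))) / 2"
          unfolding after_t before_t ln[OF w_pos(1)[OF t]] ln[OF w_pos(2)[OF t]]
          by argo
      qed
      finally show ?thesis .
    qed
    have "((\<lambda>\<sigma>. \<Sum>t\<in>{1..T}. (ln (?v \<sigma> (?wm t)) - ln (?v \<sigma> (?wp t))) / 2) \<longlongrightarrow>
        (\<Sum>t\<in>{1..T}. (ln (?wm t) - ln (?wp t)) / 2)) at_top"
      using w_pos by (intro tendsto_sum tendsto_divide tendsto_diff tendsto_const tendsto_ln_posterior_variance) auto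
    moreover have "(\<Sum>t\<in>{1..T}. (ln (?wm t) - ln (?wp t)) / 2) = \<Xi> T"
      unfolding sum_divide_distrib[symmetric] sum_ln_var_ratio[OF q T] by (simp add: \<Xi>_def)
    moreover have "eventually (\<lambda>\<sigma>. (\<Sum>t\<in>{1..T}. (ln (?v \<sigma> (?wm t)) - ln (?v \<sigma> (?wp t))) / 2) =
        expected_reward (M \<sigma>) (X0 \<sigma>) (hm \<sigma> T) (hp \<sigma> T) T) at_top"
      using eventually_gt_at_top[of 0] by eventually_elim (simp add: reward)
    ultimately show ?thesis
      using Lim_transform_eventually by fastforce
  qed
  have Gamma: "\<Xi> T = 1/2 * ln (Gamma (1 - q) * Gamma (real T + 1) / Gamma (real T + 1 - q))" for T
    using sum_ln_ratio_eq_ln_Gamma[OF q(2), of T] by (simp add: \<Xi>_def)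
  let ?D = "\<lambda>T. q * ln (real T) + ln (Gamma (1 - q))"
  have ln_top: "filterlim (\<lambda>T. ln (real T)) at_top sequentially"
    by (rule filterlim_compose[OF ln_at_top filterlim_real_sequentially])
  have D_top: "filterlim ?D at_top sequentially"
    using filterlim_tendsto_pos_mult_at_top[OF tendsto_const q(1) ln_top]
    by (intro filterlim_tendsto_add_at_top[OF tendsto_const, of _ _ "ln (Gamma (1 - q))", unfolded add.commute[of "ln (Gamma (1 - q))"]])
  have ratio: "(\<lambda>T. \<Xi> T / ?D T) \<longlonglongrightarrow> 1/2"
  proof -
    \<comment> \<open>The difference \<open>2 * \<Xi> T - ?D T\<close> tends to zero and
      \<open>?D\<close> to infinity, so \<open>\<Xi> T / ?D T\<close>, which is one half plus half
      the quotient of the two, tends to one half.\<close>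
    have "(\<lambda>T. (2 * \<Xi> T - q * ln (real T)) - ln (Gamma (1 - q))) \<longlonglongrightarrow> ln (Gamma (1 - q)) - ln (Gamma (1 - q))"
      using sum_ln_ratio_asymp[OF q(2)] by (intro tendsto_diff tendsto_const) (simp add: \<Xi>_def)
    then have "(\<lambda>T. ((2 * \<Xi> T - q * ln (real T)) - ln (Gamma (1 - q))) / ?D T) \<longlonglongrightarrow> 0"
      by (rule tendsto_divide_0[OF _ filterlim_at_top_imp_at_infinity[OF D_top]])
    then have "(\<lambda>T. 1/2 + 1/2 * (((2 * \<Xi> T - q * ln (real T)) - ln (Gamma (1 - q))) / ?D T)) \<longlonglongrightarrow> 1/2 + 1/2 * 0"
      by (intro tendsto_intros)
    moreover have "eventually (\<lambda>T. 1/2 + 1/2 * (((2 * \<Xi> T - q * ln (real T)) - ln (Gamma (1 - q))) / ?D T) =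
        \<Xi> T / ?D T) sequentially"
      using filterlim_at_top_dense[THEN iffD1, OF D_top, rule_format, of 0]
    proof eventually_elim
      case (elim T)
      then have "?D T \<noteq> 0"
        by simp
      then show ?case
        by (simp add: divide_simps)
    qed
    ultimately show ?thesis
      using Lim_transform_eventually by fastforce
  qed
  \<comment> \<open>The growth bound comes from the ratio limit, since \<open>?D\<close> is itself
    of order \<open>ln (real T)\<close>. That \<open>?D\<close> is eventually positive keeps out the
    default value of division by zero.\<close>
  have "\<Xi> \<in> O(?D)"
    by (rule bigoI_tendsto[OF ratio])
       (use filterlim_at_top_dense[THEN iffD1, OF D_top, rule_format, of 0] in \<open>auto elim: eventually_mono\<close>)
  also have "?D \<in> O(\<lambda>T. ln (real T))"
  proof (rule sum_in_bigo)
    show "(\<lambda>T. q * ln (real T)) \<in> O(\<lambda>T. ln (real T))"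
      by simp
    have "((\<lambda>T. ln (Gamma (1 - q)) / ln (real T)) \<longlongrightarrow> 0) sequentially"
      by (rule tendsto_divide_0[OF tendsto_const filterlim_at_top_imp_at_infinity[OF ln_top]])
    then show "(\<lambda>T. ln (Gamma (1 - q))) \<in> O(\<lambda>T. ln (real T))"
      by (rule bigoI_tendsto)
         (use filterlim_at_top_dense[THEN iffD1, OF ln_top, rule_format, of 0] in \<open>auto elim: eventually_mono\<close>)
  qed
  finally have bigo: "\<Xi> \<in> O(\<lambda>T. ln (real T))" .
  show ?thesis
    using limit Gamma bigo ratio by (intro exI[of _ \<Xi>]) (auto simp: \<Xi>_def)
qed

end
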